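(* Let $m\in\mathbb{N}_+$ and $\vartheta=1/\sqrt{m}$. For (Lebesgue-)almost every $x\in[0,\vartheta]$, $$\liminf_{N\to\infty}\frac{L_N(x)\log\log N}{N}=\frac1{\log(1+\vartheta^2)}.$$
   Context: $\mathbb{N}_+=\{1,2,3,\ldots\}$. Fix $m\in\mathbb{N}_+$ and let $\vartheta>0$ satisfy $\vartheta^2=1/m$. Define $T_\vartheta:[0,\vartheta]\to[0,\vartheta]$ by $T_\vartheta(0)=0$ and $T_\vartheta(x)=\frac1x-\vartheta\left\lfloor\frac1{x\vartheta}\right\rfloor$ for $x\in(0,\vartheta]$. The digits of the $\vartheta$-expansion of $x\in[0,\vartheta]$ are $b_1(x)=\left\lfloor\frac1{x\vartheta}\right\rfloor$ if $x\ne0$, $b_1(0)=\infty$, and $b_n(x)=b_1(T_\vartheta^{n-1}(x))$ for $n\ge2$. For $N\in\mathbb{N}_+$, $L_N(x)=\max_{1\le n\le N}b_n(x)$. *)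

theory Defs
  imports "HOL-Analysis.Analysis"
begin

text \<open>
  The functions below are total on the reals; they carry their intended meaning for
  \<open>\<theta> > 0\<close> and \<open>x \<in> {0..\<theta>}\<close>.
\<close>

definition theta_map :: "real \<Rightarrow> real \<Rightarrow> real" where
  "theta_map \<theta> x = (if x = 0 then 0 else 1 / x - \<theta> * of_int \<lfloor>1 / (x * \<theta>)\<rfloor>)"

text \<open>
  Digits live in \<^typ>\<open>enat\<close> since the digit of \<open>0\<close> is \<open>\<infinity>\<close>. For \<open>0 < x \<le> \<theta>\<close> the floor is
  nonnegative, so \<^const>\<open>nat\<close> does not truncate.
\<close>

definition first_digit :: "real \<Rightarrow> real \<Rightarrow> enat" where
  "first_digit \<theta> x = (if x = 0 then \<infinity> else enat (nat \<lfloor>1 / (x * \<theta>)\<rfloor>))"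

text \<open>Digits are indexed from \<open>n = 1\<close>.\<close>

definition theta_digit :: "real \<Rightarrow> nat \<Rightarrow> real \<Rightarrow> enat" where
  "theta_digit \<theta> n x = first_digit \<theta> ((theta_map \<theta> ^^ (n - 1)) x)"

text \<open>Meaningful for \<open>N \<ge> 1\<close> only, as \<^const>\<open>Max\<close> is unspecified on the empty set.\<close>

definition max_digit :: "real \<Rightarrow> nat \<Rightarrow> real \<Rightarrow> enat" where
  "max_digit \<theta> N x = Max ((\<lambda>n. theta_digit \<theta> n x) ` {1..N})"

end

theory Submission
  imports Defs "HOL-Real_Asymp.Real_Asymp" "HOL-Probability.Probability_Measure"
begin

text \<open>
  If the first \<open>n\<close> digits \<open>b\<^sub>1, \<dots>, b\<^sub>n\<close> of a uniformly distributed \<open>x\<close> are given, its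
  \<open>n\<close>-th iterate has the density \<open>t \<mapsto> (1 + \<theta> s) / (\<theta> (1 + s t)\<^sup>2)\<close>, where the state
  \<open>s = s\<^sub>n\<close> is computed by \<open>s\<^sub>0 = 0\<close> and \<open>s\<^sub>i\<^sub>+\<^sub>1 = 1 / (s\<^sub>i + b\<^sub>i\<^sub>+\<^sub>1 \<theta>)\<close>. So the digits are
  produced by a Markov chain: in state \<open>s\<close> the next digit is \<open>k\<close> with probability \<open>weight k s\<close>,
  and then the state becomes \<open>branch k s\<close>. The event that the first \<open>N\<close> digits stay below
  \<open>K\<close> is the survival up to time \<open>N\<close> of the chain that is killed with probability
  \<open>tail K s\<close>, and \<open>K tail K s\<close> is close to \<open>rate s = (1 + \<theta> s) / \<theta>\<^sup>2\<close>.

  The killing depends on the state, but the chain forgets its state exponentially fast. So only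
  the mean of \<open>rate\<close> for the stationary density \<open>c \<theta> / (1 + \<theta> s)\<close> counts, and this mean is
  \<open>c = 1 / ln (1 + \<theta>\<^sup>2)\<close>. Forgetting is proved without spectral theory. The transition
  operator turns increasing functions into decreasing ones (\<open>transition_antimono\<close>), hence it is
  enough to follow one increasing function; for \<open>x / (1 + 2 \<theta> x)\<close> the series defining the
  operator telescopes, and the operator halves Lipschitz constants measured by this function
  (\<open>transition_contract\<close>). Summing iterates of \<open>rate\<close> gives an approximate solution \<open>w\<close> of the
  Poisson equation \<open>w - transition w = rate - c\<close>, and \<open>1 - w / K\<close> is then nearly an
  eigenfunction of the killed chain with eigenvalue \<open>1 - c / K\<close>. Therefore the survival
  probability lies between \<open>(1 - (c + \<epsilon>) / K) ^ N / 2\<close> and \<open>2 (1 - (c - \<epsilon>) / K) ^ N\<close>,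
  for large \<open>K\<close> and uniformly in the initial state (\<open>survival_bounds\<close>).

  For \<open>K = b c N / ln (ln N)\<close> this is about \<open>(ln N) powr (- 1 / b)\<close>. If \<open>b < 1\<close>, it is summable
  along a geometric sequence of times, and Borel--Cantelli together with monotonicity gives the
  lower bound for the limes inferior. If \<open>b > 1\<close>, it is not summable along the much sparser times
  \<open>(j + 1) ^ (3 (j + 1))\<close>. Since the bound holds from every state, the conditional
  probabilities that successive blocks of digits contain a large one multiply to \<open>0\<close>, so almost
  surely infinitely many blocks consist of small digits only; the digits before
  such a block are so few that they are eventually small as well.
\<close>

locale theta_expansion =
  fixes m :: nat and \<theta> :: real
  assumes m_pos: "m \<ge> 1" and theta_eq: "\<theta> = 1 / sqrt (real m)"
begin

section \<open>The Markov chain behind the digits\<close>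

lemma theta_pos: "0 < \<theta>" and theta_le_1: "\<theta> \<le> 1"
  and m_theta: "real m * \<theta> = 1 / \<theta>"
proof -
  have m: "real m \<ge> 1" using m_pos by simp
  show pos: "0 < \<theta>" using m by (simp add: theta_eq)
  show "\<theta> \<le> 1" using m by (simp add: theta_eq)
  have "\<theta>\<^sup>2 = 1 / real m" using m by (simp add: theta_eq power_divide)
  then have "real m * (\<theta> * \<theta>) = 1" using m by (simp add: power2_eq_square)
  then show "real m * \<theta> = 1 / \<theta>" using pos by (simp add: field_simps)
qed

lemma m_theta_theta: "real m * (\<theta> * \<theta>) = 1"
  using m_theta theta_pos by (simp add: field_simps)

text \<open>
  The map \<open>branch k\<close> has two roles: it is the inverse branch of the expansion map on the interval
  of points with first digit \<open>k\<close>, and it updates the state of the chain when the digit \<open>k\<close>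
  occurs. This coincidence is the duality between a continued fraction and its reversal.
\<close>
definition branch :: "nat \<Rightarrow> real \<Rightarrow> real" where
  "branch k s = 1 / (s + real k * \<theta>)"

definition weight :: "nat \<Rightarrow> real \<Rightarrow> real" where
  "weight k s = (1 + \<theta> * s) / ((s + real k * \<theta>) * (s + real (Suc k) * \<theta>))"

text \<open>
  The probability, in state \<open>s\<close>, that the next digit is at least \<open>k\<close>.
\<close>
definition tail :: "nat \<Rightarrow> real \<Rightarrow> real" where
  "tail k s = (1 + \<theta> * s) / (\<theta> * (s + real k * \<theta>))"

lemma denom_pos: "0 \<le> s \<Longrightarrow> m \<le> k \<Longrightarrow> 0 < s + real k * \<theta>"
  using theta_pos m_pos by (intro add_nonneg_pos mult_pos_pos) auto

lemma denom_ge: "0 \<le> s \<Longrightarrow> m \<le> k \<Longrightarrow> 1 / \<theta> \<le> s + real k * \<theta>"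
  using mult_right_mono[of "real m" "real k" \<theta>] theta_pos m_theta by simp

lemma branch_mem: assumes "0 \<le> s" "m \<le> k" shows "branch k s \<in> {0..\<theta>}"
proof -
  have "1 / (s + real k * \<theta>) \<le> 1 / (1 / \<theta>)"
    using denom_ge[OF assms] denom_pos[OF assms] theta_pos by (intro divide_left_mono) auto
  then show ?thesis using denom_pos[OF assms] by (simp add: branch_def)
qed

lemma weight_tail:
  assumes "0 \<le> s" "m \<le> k" shows "weight k s = tail k s - tail (Suc k) s"
proof -
  define D where "D = s + real k * \<theta>"
  have 1: "D > 0" using denom_pos[OF assms] by (simp add: D_def)
  have 2: "s + real (Suc k) * \<theta> = D + \<theta>" by (simp add: D_def algebra_simps)
  have 3: "D + \<theta> > 0" using 1 theta_pos by simp
  show ?thesis unfolding weight_def tail_def 2 D_def[symmetric]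
    using 1 3 theta_pos by (simp add: divide_simps) (simp add: algebra_simps)
qed

lemma weight_nonneg: assumes "0 \<le> s" "m \<le> k" shows "0 \<le> weight k s"
  using denom_pos[of s k] denom_pos[of s "Suc k"] assms theta_pos
  unfolding weight_def by (intro divide_nonneg_pos mult_pos_pos add_nonneg_nonneg) auto

lemma tail_m: "0 \<le> s \<Longrightarrow> tail m s = 1"
proof -
  assume s: "0 \<le> s"
  have "\<theta> * (s + real m * \<theta>) = 1 + \<theta> * s" using m_theta_theta by (simp add: algebra_simps)
  moreover have "1 + \<theta> * s > 0" using s theta_pos by (simp add: add_pos_nonneg)
  ultimately show ?thesis by (simp add: tail_def)
qed

lemma tail_nonneg: assumes "0 \<le> s" "m \<le> k" shows "0 \<le> tail k s"
  using denom_pos[OF assms] theta_pos assms by (simp add: tail_def)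

text \<open>
  Larger states make larger digits more likely. Together with the fact that \<open>branch\<close> decreases in
  both arguments, this stochastic monotonicity is what makes the chain easy to control.
\<close>
lemma tail_mono: assumes "0 \<le> x" "x \<le> y" "m \<le> k" shows "tail k x \<le> tail k y"
proof -
  have "real m * (\<theta> * \<theta>) \<le> real k * (\<theta> * \<theta>)"
    using assms by (intro mult_right_mono) auto
  then have "0 \<le> (y - x) * (real k * (\<theta> * \<theta>) - 1)"
    using assms m_theta_theta by (intro mult_nonneg_nonneg) auto
  then have "(1 + \<theta> * x) * (y + real k * \<theta>) \<le> (1 + \<theta> * y) * (x + real k * \<theta>)"
    by (simp add: algebra_simps)
  then have "(1 + \<theta> * x) / (x + real k * \<theta>) \<le> (1 + \<theta> * y) / (y + real k * \<theta>)"
    using denom_pos[of x k] denom_pos[of y k] assms by (simp add: divide_simps)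
  from divide_right_mono[OF this, of \<theta>] show ?thesis
    using theta_pos by (simp add: tail_def mult.commute)
qed

lemma tail_tendsto: "(\<lambda>n. tail (m + n) s) \<longlonglongrightarrow> 0"
  unfolding tail_def using theta_pos by real_asymp

lemma weight_partial_sum:
  assumes "0 \<le> s" shows "(\<Sum>i<n. weight (m + i) s) = 1 - tail (m + n) s"
  by (induction n) (auto simp: weight_tail assms tail_m)

lemma weight_sums: assumes "0 \<le> s" shows "(\<lambda>i. weight (m + i) s) sums 1"
  unfolding sums_def weight_partial_sum[OF assms]
  using tendsto_diff[OF tendsto_const tail_tendsto, of 1 s] by simp

section \<open>Exponential forgetting\<close>

definition transition :: "(real \<Rightarrow> real) \<Rightarrow> real \<Rightarrow> real" where
  "transition f s = (\<Sum>i. weight (m + i) s * f (branch (m + i) s))"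

lemma transition_abs_summable:
  assumes "\<And>t. t \<in> {0..\<theta>} \<Longrightarrow> \<bar>f t\<bar> \<le> B" "0 \<le> s"
  shows "summable (\<lambda>i. weight (m + i) s * f (branch (m + i) s))"
proof (rule summable_comparison_test')
  show "summable (\<lambda>i. weight (m + i) s * B)"
    using weight_sums[OF assms(2)] by (intro summable_mult2) (auto simp: sums_iff)
  show "norm (weight (m + n) s * f (branch (m + n) s)) \<le> weight (m + n) s * B" for n
    using assms branch_mem[of s "m+n"] weight_nonneg[of s "m+n"]
    by (auto simp: abs_mult intro!: mult_left_mono)
qed

lemma transition_mono:
  assumes "\<And>t. t \<in> {0..\<theta>} \<Longrightarrow> \<bar>f t\<bar> \<le> B" "\<And>t. t \<in> {0..\<theta>} \<Longrightarrow> \<bar>h t\<bar> \<le> B'"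
    "\<And>t. t \<in> {0..\<theta>} \<Longrightarrow> f t \<le> h t" "0 \<le> s"
  shows "transition f s \<le> transition h s"
  unfolding transition_def
  using assms branch_mem weight_nonneg
  by (intro suminf_le transition_abs_summable[of f B] transition_abs_summable[of h B']) (auto intro!: mult_left_mono)

lemma transition_const: "0 \<le> s \<Longrightarrow> transition (\<lambda>_. a) s = a"
  using sums_mult2[OF weight_sums[of s], of a] by (simp add: transition_def sums_iff)

lemma transition_add_scaled:
  assumes "\<And>t. t \<in> {0..\<theta>} \<Longrightarrow> \<bar>f t\<bar> \<le> B" "\<And>t. t \<in> {0..\<theta>} \<Longrightarrow> \<bar>h t\<bar> \<le> B'" "0 \<le> s"
  shows "transition (\<lambda>t. a * f t + b * h t) s = a * transition f s + b * transition h s"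
proof -
  have "(\<lambda>i. a * (weight (m + i) s * f (branch (m + i) s)) + b * (weight (m + i) s * h (branch (m + i) s)))
      sums (a * transition f s + b * transition h s)"
    unfolding transition_def
    by (intro sums_add sums_mult summable_sums transition_abs_summable[of f B] transition_abs_summable[of h B'] assms)
  then show ?thesis by (simp add: transition_def sums_iff algebra_simps)
qed

text \<open>
  Summation by parts: rearranging a sum with decreasing factors \<open>a\<close> by the partial sums of
  \<open>d\<close> leaves only nonnegative terms besides the boundary term.
\<close>
lemma abel_sum_nonneg:
  fixes a d :: "nat \<Rightarrow> real"
  assumes "\<And>n. a (Suc n) \<le> a n" "\<And>n. 0 \<le> (\<Sum>i<n. d i)"
  shows "(\<Sum>i<n. d i) * a n \<le> (\<Sum>i<n. d i * a i)"
proof (induction n)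
  case (Suc n)
  have "(\<Sum>i<Suc n. d i) * a (Suc n) \<le> (\<Sum>i<Suc n. d i) * a n"
    by (intro mult_left_mono assms)
  also have "\<dots> \<le> (\<Sum>i<Suc n. d i * a i)" using Suc.IH by (simp add: algebra_simps)
  finally show ?case .
qed simp

text \<open>
  If the state grows, each \<open>branch\<close> value falls and, by \<open>tail_mono\<close>, the weights move towards
  larger digits, where \<open>branch\<close> is smaller again. Both effects lower the expected value of an
  increasing function.
\<close>
lemma transition_antimono:
  assumes bdd: "\<And>t. t \<in> {0..\<theta>} \<Longrightarrow> \<bar>f t\<bar> \<le> B"
    and mono: "\<And>s t. 0 \<le> s \<Longrightarrow> s \<le> t \<Longrightarrow> t \<le> \<theta> \<Longrightarrow> f s \<le> f t"
    and xy: "0 \<le> x" "x \<le> y"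
  shows "transition f y \<le> transition f x"
proof -
  have y: "0 \<le> y" using xy by simp
  \<comment> \<open>Subtracting \<open>f 0\<close> makes the factors nonnegative, so the boundary term of \<open>abel_sum_nonneg\<close> can be dropped.\<close>
  define a where "a i = f (branch (m + i) y) - f 0" for i
  have a_nonneg: "0 \<le> a i" for i
    using mono[of 0 "branch (m+i) y"] branch_mem[OF y, of "m+i"] by (auto simp: a_def)
  have b_mono: "branch (m + Suc i) y \<le> branch (m + i) y" for i
    using denom_pos[OF y, of "m+i"] denom_pos[OF y, of "m+Suc i"] theta_pos
    unfolding branch_def by (intro divide_left_mono mult_pos_pos) (auto simp: algebra_simps)
  have a_dec: "a (Suc i) \<le> a i" for i
    unfolding a_def using mono[OF _ b_mono] branch_mem[OF y] by auto
  define d where "d i = weight (m + i) x - weight (m + i) y" for i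
  have dsum: "(\<Sum>i<n. d i) = tail (m + n) y - tail (m + n) x" for n
    using xy y by (simp add: d_def sum_subtractf weight_partial_sum)
  have d_nonneg: "0 \<le> (\<Sum>i<n. d i)" for n
    using tail_mono[OF xy] by (simp add: dsum)
  have "0 \<le> (\<Sum>i<n. d i) * a n" for n using d_nonneg a_nonneg by (intro mult_nonneg_nonneg)
  then have part: "0 \<le> (\<Sum>i<n. d i * a i)" for n
    using abel_sum_nonneg[of a d n] a_dec d_nonneg by (meson order_trans)
  have bdd0: "\<bar>f t - f 0\<bar> \<le> 2 * B" if "t \<in> {0..\<theta>}" for t
    using bdd[OF that] bdd[of 0] theta_pos by auto
  have bddy: "\<bar>f (branch (m + i) y) - f 0\<bar> \<le> 2 * B" for i
    using bdd0 branch_mem[OF y] by simp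
  have sx: "summable (\<lambda>i. weight (m + i) x * a i)"
  proof (rule summable_comparison_test')
    show "summable (\<lambda>i. weight (m + i) x * (2 * B))"
      using weight_sums[OF xy(1)] by (intro summable_mult2) (auto simp: sums_iff)
    show "norm (weight (m + n) x * a n) \<le> weight (m + n) x * (2 * B)" for n
      using bddy[of n] weight_nonneg[of x "m+n"] xy by (auto simp: a_def abs_mult intro!: mult_left_mono)
  qed
  have sy: "summable (\<lambda>i. weight (m + i) y * a i)"
    using transition_abs_summable[OF bdd0 y] by (simp add: a_def)
  have Uy: "transition f y = f 0 + (\<Sum>i. weight (m + i) y * a i)"
  proof -
    have "transition (\<lambda>t. 1 * (f t - f 0) + f 0 * 1) y = 1 * transition (\<lambda>t. f t - f 0) y + f 0 * transition (\<lambda>_. 1) y"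
      by (rule transition_add_scaled[of "\<lambda>t. f t - f 0" "2 * B" "\<lambda>_. 1" 1]) (use bdd0 xy in auto)
    then show ?thesis using y by (simp add: transition_const) (simp add: transition_def a_def)
  qed
  have "0 \<le> (\<Sum>i. weight (m + i) x * a i) - (\<Sum>i. weight (m + i) y * a i)"
  proof (rule LIMSEQ_le_const)
    show "(\<lambda>n. \<Sum>i<n. d i * a i) \<longlonglongrightarrow> (\<Sum>i. weight (m + i) x * a i) - (\<Sum>i. weight (m + i) y * a i)"
      using sums_diff[OF summable_sums[OF sx] summable_sums[OF sy]]
      by (simp add: sums_def d_def algebra_simps)
  qed (use part in auto)
  also have "\<dots> \<le> (transition f x - f 0) - (\<Sum>i. weight (m + i) y * a i)"
  proof -
    have "transition (\<lambda>t. 1 * (f t - f 0) + f 0 * 1) x = 1 * transition (\<lambda>t. f t - f 0) x + f 0 * transition (\<lambda>_. 1) x"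
      by (rule transition_add_scaled[of "\<lambda>t. f t - f 0" "2 * B" "\<lambda>_. 1" 1]) (use bdd0 xy in auto)
    then have Ux: "transition f x = f 0 + transition (\<lambda>t. f t - f 0) x" using xy by (simp add: transition_const)
    have "branch (m + i) y \<le> branch (m + i) x" for i
      using denom_pos[OF y, of "m+i"] denom_pos[OF xy(1), of "m+i"] xy
      unfolding branch_def by (intro divide_left_mono) auto
    then have "a i \<le> f (branch (m + i) x) - f 0" for i
      using mono branch_mem[of y "m+i"] branch_mem[of x "m+i"] xy y by (auto simp: a_def)
    then have "(\<Sum>i. weight (m + i) x * a i) \<le> transition (\<lambda>t. f t - f 0) x"
      unfolding transition_def
      by (intro suminf_le sx transition_abs_summable[OF bdd0 xy(1)] mult_left_mono weight_nonneg xy) auto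
    then show ?thesis using Ux by simp
  qed
  finally show ?thesis using Uy by simp
qed

text \<open>
  At \<open>1 / D\<close> the function takes the value \<open>1 / (D + 2 \<theta>)\<close>. This is the third factor that turns the weights
  \<open>1 / (D (D + \<theta>))\<close> into a telescoping series over the progression of step \<open>\<theta>\<close>, so that
  its image under the transition operator is explicit.
\<close>
definition gauge :: "real \<Rightarrow> real" where "gauge x = x / (1 + 2 * \<theta> * x)"

lemma gauge_diff:
  assumes "0 \<le> x" "0 \<le> y"
  shows "gauge y - gauge x = (y - x) / ((1 + 2 * \<theta> * x) * (1 + 2 * \<theta> * y))"
proof -
  have "1 + 2 * \<theta> * x > 0" "1 + 2 * \<theta> * y > 0" using assms theta_pos by (auto intro: add_pos_nonneg)
  then show ?thesis unfolding gauge_def by (simp add: divide_simps) (simp add: algebra_simps)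
qed

lemma gauge_bound: assumes "t \<in> {0..\<theta>}" shows "\<bar>gauge t\<bar> \<le> \<theta>"
proof -
  have "0 \<le> gauge t" using assms theta_pos by (auto simp: gauge_def)
  moreover have "gauge t \<le> t" using assms theta_pos
    unfolding gauge_def by (auto simp: divide_simps mult_le_cancel_left1 add_pos_nonneg)
  ultimately show ?thesis using assms by auto
qed

lemma transition_gauge:
  assumes "0 \<le> s" shows "transition gauge s = 1 / (2 * (s + real (Suc m) * \<theta>))"
proof -
  define D where "D i = s + real (m + i) * \<theta>" for i
  have Dpos: "D i > 0" for i using denom_pos[OF assms, of "m+i"] by (simp add: D_def)
  have DSuc: "D (Suc i) = D i + \<theta>" for i by (simp add: D_def algebra_simps)
  define F where "F i = (1 + \<theta> * s) / (2 * \<theta> * (D i * D (Suc i)))" for i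
  have "weight (m + i) s * gauge (branch (m + i) s) = F i - F (Suc i)" for i
  proof -
    have 1: "weight (m + i) s = (1 + \<theta> * s) / (D i * (D i + \<theta>))"
      unfolding weight_def DSuc[symmetric] by (simp add: D_def)
    have 2: "gauge (branch (m + i) s) = 1 / (D i + 2 * \<theta>)"
      using Dpos[of i] theta_pos unfolding gauge_def branch_def D_def[symmetric]
      by (simp add: divide_simps)
    have "D i + \<theta> > 0" "D i + 2 * \<theta> > 0" "D i + \<theta> + \<theta> > 0" using Dpos[of i] theta_pos by auto
    then show ?thesis unfolding 1 2 F_def DSuc using Dpos[of i] theta_pos
      by (simp add: divide_simps) (simp add: algebra_simps)
  qed
  moreover have "F \<longlonglongrightarrow> 0" unfolding F_def D_def using theta_pos by real_asymp
  ultimately have "(\<lambda>i. weight (m + i) s * gauge (branch (m + i) s)) sums (F 0 - 0)"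
    using telescope_sums'[of F 0] by simp
  then have "transition gauge s = F 0" by (simp add: transition_def sums_iff)
  also have "\<dots> = 1 / (2 * (s + real (Suc m) * \<theta>))"
  proof -
    have "\<theta> * D 0 = 1 + \<theta> * s" using m_theta theta_pos by (simp add: D_def field_simps)
    then have "F 0 = (\<theta> * D 0) / (2 * \<theta> * (D 0 * D 1))" by (simp add: F_def)
    also have "\<dots> = 1 / (2 * D 1)" using Dpos[of 0] theta_pos by simp
    finally show ?thesis by (simp add: D_def)
  qed
  finally show ?thesis .
qed

text \<open>
  In the explicit differences of both sides the numerators agree, so the claim is the
  comparison \<open>1 + 2 \<theta> t \<le> t + \<theta> + 1 / \<theta>\<close> of the factors in the denominators. The factor
  \<open>1 / 2\<close> is already present in \<open>transition_gauge\<close>.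
\<close>
lemma transition_gauge_contract:
  assumes "0 \<le> x" "x \<le> y" "y \<le> \<theta>"
  shows "transition gauge x - transition gauge y \<le> (gauge y - gauge x) / 2"
proof -
  define a where "a = real (Suc m) * \<theta>"
  have a: "a = 1 / \<theta> + \<theta>" using m_theta by (simp add: a_def algebra_simps)
  have le: "1 + 2 * \<theta> * t \<le> t + a" if "0 \<le> t" "t \<le> \<theta>" for t
  proof -
    have "0 \<le> \<theta> * t * (1 - \<theta>) + (1 - \<theta>) + \<theta> * \<theta> * (1 - t)"
      using that theta_pos theta_le_1 by (intro add_nonneg_nonneg mult_nonneg_nonneg) auto
    then have "\<theta> * (1 + 2 * \<theta> * t) \<le> \<theta> * (t + a)"
      using theta_pos by (simp add: a algebra_simps)
    then show ?thesis using theta_pos by simp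
  qed
  have pos: "1 + 2 * \<theta> * x > 0" "1 + 2 * \<theta> * y > 0" using assms theta_pos by (auto intro: add_pos_nonneg)
  have pos': "x + a > 0" "y + a > 0" using le[of x] le[of y] pos assms by linarith+
  have "transition gauge t = 1 / (2 * (t + a))" if "0 \<le> t" for t
    using transition_gauge[OF that] by (simp only: a_def)
  then have "transition gauge x - transition gauge y = 1 / (2 * (x + a)) - 1 / (2 * (y + a))" using assms by simp
  also have "\<dots> = (y - x) / (2 * ((x + a) * (y + a)))"
    using pos' by (simp add: divide_simps) (simp add: algebra_simps)
  also have "\<dots> \<le> (y - x) / (2 * ((1 + 2 * \<theta> * x) * (1 + 2 * \<theta> * y)))"
    using assms pos pos' le[of x] le[of y]
    by (intro divide_left_mono mult_left_mono mult_mono mult_pos_pos) auto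
  also have "\<dots> = (gauge y - gauge x) / 2" using assms by (simp add: gauge_diff)
  finally show ?thesis .
qed

definition gauge_lipschitz :: "real \<Rightarrow> (real \<Rightarrow> real) \<Rightarrow> bool" where
  "gauge_lipschitz M f \<longleftrightarrow>
    (\<forall>x y. 0 \<le> x \<longrightarrow> x \<le> y \<longrightarrow> y \<le> \<theta> \<longrightarrow> \<bar>f y - f x\<bar> \<le> M * (gauge y - gauge x))"

text \<open>
  A function is \<open>M\<close>-Lipschitz for \<open>gauge\<close> exactly if \<open>M gauge + f\<close> and \<open>M gauge - f\<close> are
  increasing. The operator makes both of them decreasing, which bounds the increments of the image
  of \<open>f\<close> by those of the image of \<open>M gauge\<close>.
\<close>
lemma transition_contract:
  assumes bdd: "\<And>t. t \<in> {0..\<theta>} \<Longrightarrow> \<bar>f t\<bar> \<le> B"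
    and lip: "gauge_lipschitz M f" and "0 \<le> M"
  shows "gauge_lipschitz (M / 2) (transition f)"
  unfolding gauge_lipschitz_def
proof (intro allI impI)
  fix x y :: real assume xy: "0 \<le> x" "x \<le> y" "y \<le> \<theta>"
  \<comment> \<open>The sign \<open>c\<close> stands for \<open>1\<close> or \<open>-1\<close>, to treat \<open>M gauge + f\<close> and \<open>M gauge - f\<close> together.\<close>
  have *: "c * (transition f y - transition f x) \<le> M / 2 * (gauge y - gauge x)" if c: "\<bar>c\<bar> = 1" for c
  proof -
    define h where "h t = M * gauge t + c * f t" for t
    have "\<bar>h t\<bar> \<le> M * \<theta> + B" if "t \<in> {0..\<theta>}" for t
    proof -
      have "\<bar>h t\<bar> \<le> \<bar>M * gauge t\<bar> + \<bar>c * f t\<bar>" unfolding h_def by (rule abs_triangle_ineq)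
      also have "\<dots> \<le> M * \<theta> + B"
        using gauge_bound[OF that] bdd[OF that] c \<open>0 \<le> M\<close>
        by (intro add_mono) (auto simp: abs_mult mult_left_mono)
      finally show ?thesis .
    qed
    moreover have "h s \<le> h t" if "0 \<le> s" "s \<le> t" "t \<le> \<theta>" for s t
    proof -
      have "c * (f s - f t) \<le> \<bar>c * (f s - f t)\<bar>" by simp
      also have "\<dots> = \<bar>f t - f s\<bar>" using c by (simp add: abs_mult)
      also have "\<dots> \<le> M * (gauge t - gauge s)" using lip that by (auto simp: gauge_lipschitz_def)
      finally show ?thesis by (simp add: h_def algebra_simps)
    qed
    ultimately have "transition h y \<le> transition h x" by (rule transition_antimono) (use xy in auto)
    moreover have "transition h s = M * transition gauge s + c * transition f s" if "0 \<le> s" for s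
      unfolding h_def by (rule transition_add_scaled[of gauge \<theta> f B]) (use gauge_bound bdd that in auto)
    ultimately have "c * (transition f y - transition f x) \<le> M * (transition gauge x - transition gauge y)"
      using xy by (simp add: algebra_simps)
    also have "\<dots> \<le> M * ((gauge y - gauge x) / 2)"
      using \<open>0 \<le> M\<close> transition_gauge_contract[OF xy] by (intro mult_left_mono)
    finally show ?thesis by simp
  qed
  show "\<bar>transition f y - transition f x\<bar> \<le> M / 2 * (gauge y - gauge x)"
    using *[of 1] *[of "-1"] by (intro abs_leI) simp_all
qed

text \<open>
  The limit of \<open>K tail K s\<close> as \<open>K\<close> grows.
\<close>
definition rate :: "real \<Rightarrow> real" where "rate s = (1 + \<theta> * s) / \<theta>\<^sup>2"

lemma rate_bounds: assumes "s \<in> {0..\<theta>}" shows "0 \<le> rate s" "rate s \<le> real m + 1"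
proof -
  show "0 \<le> rate s" using assms theta_pos by (auto simp: rate_def)
  have "\<theta> * s \<le> \<theta> * \<theta>" using assms theta_pos by auto
  then have "rate s \<le> (1 + \<theta> * \<theta>) / \<theta>\<^sup>2" unfolding rate_def by (intro divide_right_mono) auto
  also have "\<dots> = real m + 1" using m_theta_theta theta_pos
    by (simp add: field_simps power2_eq_square)
  finally show "rate s \<le> real m + 1" .
qed

lemma rate_lipschitz: "gauge_lipschitz (9 / \<theta>) rate"
  unfolding gauge_lipschitz_def
proof (intro allI impI)
  fix x y :: real assume xy: "0 \<le> x" "x \<le> y" "y \<le> \<theta>"
  have le: "1 + 2 * \<theta> * t \<le> 3" if "0 \<le> t" "t \<le> \<theta>" for t
    using mult_mono[of \<theta> 1 t 1] that theta_pos theta_le_1 by auto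
  have "(1 + 2 * \<theta> * x) * (1 + 2 * \<theta> * y) \<le> 3 * 3"
    using le xy theta_pos by (intro mult_mono) auto
  moreover have "(1 + 2 * \<theta> * x) * (1 + 2 * \<theta> * y) > 0"
    using xy theta_pos by (intro mult_pos_pos add_pos_nonneg) auto
  ultimately have "(y - x) / 9 \<le> (y - x) / ((1 + 2 * \<theta> * x) * (1 + 2 * \<theta> * y))"
    using xy by (intro divide_left_mono) simp_all
  then have "(y - x) / 9 \<le> gauge y - gauge x" using xy by (simp add: gauge_diff)
  then have "9 / \<theta> * ((y - x) / 9) \<le> 9 / \<theta> * (gauge y - gauge x)"
    using theta_pos by (intro mult_left_mono) auto
  moreover have "9 / \<theta> * ((y - x) / 9) = (y - x) / \<theta>" using theta_pos by (simp add: field_simps)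
  moreover have "rate y - rate x = (y - x) / \<theta>"
    using theta_pos by (simp add: rate_def field_simps power2_eq_square)
  moreover have "0 \<le> (y - x) / \<theta>" using xy theta_pos by simp
  ultimately show "\<bar>rate y - rate x\<bar> \<le> 9 / \<theta> * (gauge y - gauge x)"
    by (simp only: abs_of_nonneg)
qed

lemma transition_iter_rate:
  shows "s \<in> {0..\<theta>} \<Longrightarrow> 0 \<le> (transition ^^ n) rate s \<and> (transition ^^ n) rate s \<le> real m + 1"
    and "gauge_lipschitz (9 / \<theta> / 2 ^ n) ((transition ^^ n) rate)"
proof (induction n arbitrary: s)
  case 0
  { case 1 then show ?case using rate_bounds by simp }
  { case 2 then show ?case using rate_lipschitz by simp }
next
  case (Suc n)
  have b: "t \<in> {0..\<theta>} \<Longrightarrow> \<bar>(transition ^^ n) rate t\<bar> \<le> real m + 1" for t using Suc(1)[of t] by auto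
  { case 1
    have "transition (\<lambda>_. 0) s \<le> transition ((transition ^^ n) rate) s" "transition ((transition ^^ n) rate) s \<le> transition (\<lambda>_. real m + 1) s"
      using Suc(1) b 1 by (auto intro!: transition_mono[of _ "real m + 1" _ "real m + 1"])
    then show ?case using 1 by (simp add: transition_const) }
  { case 2
    then show ?case using transition_contract[OF b Suc(2)] theta_pos by (simp add: field_simps) }
qed

lemma transition_iter_rate_osc:
  assumes "x \<in> {0..\<theta>}" "y \<in> {0..\<theta>}"
  shows "\<bar>(transition ^^ n) rate y - (transition ^^ n) rate x\<bar> \<le> 18 / 2 ^ n"
proof -
  have *: "\<bar>(transition ^^ n) rate y - (transition ^^ n) rate x\<bar> \<le> 18 / 2 ^ n" if "0 \<le> x" "x \<le> y" "y \<le> \<theta>" for x y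
  proof -
    have "\<bar>(transition ^^ n) rate y - (transition ^^ n) rate x\<bar> \<le> 9 / \<theta> / 2 ^ n * (gauge y - gauge x)"
      using transition_iter_rate(2)[of n] that unfolding gauge_lipschitz_def by blast
    also have "\<dots> \<le> 9 / \<theta> / 2 ^ n * (\<theta> + \<theta>)"
      using gauge_bound[of x] gauge_bound[of y] that theta_pos by (intro mult_left_mono) auto
    also have "\<dots> = 18 / 2 ^ n" using theta_pos by (simp add: field_simps)
    finally show ?thesis .
  qed
  show ?thesis using *[of x y] *[of y x] assms by (cases "x \<le> y") (auto simp: abs_minus_commute)
qed

section \<open>The stationary density and the constant\<close>

text \<open>
  Integration against the stationary density of the chain, without its normalisation.
\<close>
definition mean :: "(real \<Rightarrow> real) \<Rightarrow> real" where
  "mean f = integral {0..\<theta>} (\<lambda>s. f s / (1 + \<theta> * s))"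

text \<open>
  The mean of \<open>rate\<close> for the stationary probability density \<open>c \<theta> / (1 + \<theta> s)\<close>.
\<close>
definition c :: real where "c = 1 / ln (1 + \<theta>\<^sup>2)"

lemma one_plus_pos: "0 \<le> s \<Longrightarrow> 0 < 1 + \<theta> * s"
  using theta_pos by (simp add: add_pos_nonneg)

lemma branch_theta: "branch k \<theta> = branch (Suc k) 0"
  by (simp add: branch_def algebra_simps)

lemma branch_m_0: "branch m 0 = \<theta>"
  by (simp add: branch_def m_theta)

text \<open>
  The substitution \<open>t = branch k s\<close> turns the contribution of the digit \<open>k\<close> into an integral
  over the interval of points with first digit \<open>k\<close>.
\<close>
lemma branch_has_integral:
  assumes "continuous_on {0..\<theta>} f" "m \<le> k"
  shows "((\<lambda>s. weight k s * f (branch k s) / (1 + \<theta> * s)) has_integral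
    integral {branch (Suc k) 0..branch k 0} (\<lambda>t. f t / (1 + \<theta> * t))) {0..\<theta>}"
proof -
  define F where "F t = f t / (1 + \<theta> * t)" for t
  have F: "continuous_on {0..\<theta>} F"
    unfolding F_def using assms(1) one_plus_pos by (intro continuous_intros) force+
  define b' where "b' s = - 1 / (s + real k * \<theta>)\<^sup>2" for s
  have D: "0 < s + real k * \<theta>" if "s \<in> {0..\<theta>}" for s using denom_pos[of s k] that assms by simp
  have deriv: "(branch k has_field_derivative b' s) (at s within {0..\<theta>})" if "s \<in> {0..\<theta>}" for s
    unfolding branch_def b'_def using D[OF that]
    by (auto intro!: derivative_eq_intros simp: power2_eq_square)
  have "((\<lambda>s. b' s *\<^sub>R F (branch k s)) has_integral
      (integral {branch k 0..branch k \<theta>} F - integral {branch k \<theta>..branch k 0} F)) {0..\<theta>}"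
  proof (rule has_integral_substitution_general[OF finite.emptyI _ _ F])
    show "continuous_on {0..\<theta>} (branch k)" using deriv by (rule DERIV_continuous_on)
    show "branch k ` {0..\<theta>} \<subseteq> {0..\<theta>}"
      by (rule image_subsetI, rule branch_mem) (use assms in simp_all)
  qed (use deriv theta_pos in auto)
  moreover have "branch k \<theta> < branch k 0"
    unfolding branch_def
    by (rule divide_strict_left_mono) (use D[of 0] D[of \<theta>] theta_pos in simp_all)
  ultimately have "((\<lambda>s. b' s *\<^sub>R F (branch k s)) has_integral
      (- integral {branch (Suc k) 0..branch k 0} F)) {0..\<theta>}"
    by (simp add: branch_theta)
  from has_integral_neg[OF this]
  have "((\<lambda>s. - (b' s *\<^sub>R F (branch k s))) has_integral
      integral {branch (Suc k) 0..branch k 0} F) {0..\<theta>}" by simp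
  moreover have "- (b' s *\<^sub>R F (branch k s)) = weight k s * f (branch k s) / (1 + \<theta> * s)"
    if "s \<in> {0..\<theta>}" for s
  proof -
    define d where "d = s + real k * \<theta>"
    have d: "d > 0" using D[OF that] by (simp add: d_def)
    have 2: "s + real (Suc k) * \<theta> = d + \<theta>" by (simp add: d_def algebra_simps)
    have 3: "d + \<theta> > 0" using d theta_pos by simp
    have 4: "1 + \<theta> * s > 0" using that one_plus_pos by simp
    have "F (1 / d) = f (1 / d) * (d / (d + \<theta>))" unfolding F_def using d 3 by (simp add: field_simps)
    moreover have "weight k s / (1 + \<theta> * s) = 1 / (d * (d + \<theta>))"
      unfolding weight_def 2 d_def[symmetric] using 4 by simp
    moreover have "weight k s * f (1 / d) / (1 + \<theta> * s) = weight k s / (1 + \<theta> * s) * f (1 / d)"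
      by simp
    ultimately have F1: "F (1 / d) = f (1 / d) * (d / (d + \<theta>))"
      and W1: "weight k s * f (1 / d) / (1 + \<theta> * s) = 1 / (d * (d + \<theta>)) * f (1 / d)"
      by (simp_all only:)
    have "1 / (d * (d + \<theta>)) * f (1 / d) = F (1 / d) / d\<^sup>2"
      unfolding F1 using d 3 by (simp add: power2_eq_square)
    with W1 have "weight k s * f (1 / d) / (1 + \<theta> * s) = F (1 / d) / d\<^sup>2" by (simp only:)
    then show ?thesis unfolding b'_def branch_def d_def[symmetric] by simp
  qed
  ultimately show ?thesis unfolding F_def by (metis (no_types, lifting) has_integral_eq)
qed

lemma sum_branch_integrals:
  assumes "continuous_on {0..\<theta>} F"
  shows "(\<Sum>i<n. integral {branch (Suc (m + i)) 0..branch (m + i) 0} F)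
    = integral {branch (m + n) 0..\<theta>} (F :: real \<Rightarrow> real)"
proof (induction n)
  case 0
  show ?case by (simp add: branch_m_0)
next
  case (Suc n)
  let ?a = "branch (Suc (m + n)) 0" and ?b = "branch (m + n) 0"
  have "?a \<le> ?b"
    using denom_pos[of 0 "m+n"] denom_pos[of 0 "m + Suc n"] theta_pos
    unfolding branch_def by (intro divide_left_mono mult_pos_pos) (auto simp: algebra_simps)
  moreover have "?b \<le> \<theta>" "0 \<le> ?a" using branch_mem[of 0 "m+n"] branch_mem[of 0 "Suc (m+n)"] by auto
  moreover have "F integrable_on {?a..\<theta>}"
    using assms calculation(3)
    by (intro integrable_continuous_real continuous_on_subset[OF assms]) auto
  ultimately have "integral {?a..?b} F + integral {?b..\<theta>} F = integral {?a..\<theta>} F"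
    by (intro Henstock_Kurzweil_Integration.integral_combine)
  then show ?case using Suc by simp
qed

text \<open>
  The intervals of \<open>branch_has_integral\<close> tile \<open>(0, \<theta>]\<close>, which is the invariance of the
  density \<open>1 / (1 + \<theta> s)\<close>. Divided by \<open>1 + \<theta> s\<close> the series is dominated by a multiple of
  its weights at \<open>s = 0\<close>, so it converges uniformly and can be integrated term by term.
\<close>
lemma mean_transition:
  assumes f: "continuous_on {0..\<theta>} f"
  shows "continuous_on {0..\<theta>} (transition f)" "mean (transition f) = mean f"
proof -
  define F where "F t = f t / (1 + \<theta> * t)" for t
  define T where "T i s = weight (m + i) s * f (branch (m + i) s) / (1 + \<theta> * s)" for i s
  have F: "continuous_on {0..\<theta>} F"
    unfolding F_def using f one_plus_pos by (intro continuous_intros) force+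
  have "compact (f ` {0..\<theta>})" using f by (intro compact_continuous_image) auto
  then have "\<exists>B. \<forall>t\<in>{0..\<theta>}. \<bar>f t\<bar> \<le> B"
    by (auto dest!: compact_imp_bounded simp: bounded_iff)
  then obtain B where B: "\<And>t. t \<in> {0..\<theta>} \<Longrightarrow> \<bar>f t\<bar> \<le> B" by blast
  have B0: "0 \<le> B" using B[of 0] theta_pos by auto
  have T_le: "norm (T i s) \<le> weight (m + i) 0 * B" if "s \<in> {0..\<theta>}" for i s
  proof -
    have s: "0 \<le> s" using that by simp
    have "weight (m + i) s / (1 + \<theta> * s) = 1 / ((s + real (m + i) * \<theta>) * (s + real (Suc (m + i)) * \<theta>))"
      using one_plus_pos[OF s] by (simp add: weight_def)
    also have "\<dots> \<le> 1 / ((0 + real (m + i) * \<theta>) * (0 + real (Suc (m + i)) * \<theta>))"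
      using denom_pos[of s "m+i"] denom_pos[of s "Suc (m+i)"] denom_pos[of 0 "m+i"]
        denom_pos[of 0 "Suc (m+i)"] s theta_pos
      by (intro divide_left_mono mult_mono mult_pos_pos) auto
    finally have 1: "weight (m + i) s / (1 + \<theta> * s) \<le> weight (m + i) 0" by (simp add: weight_def)
    have "norm (T i s) = weight (m + i) s / (1 + \<theta> * s) * \<bar>f (branch (m + i) s)\<bar>"
      using weight_nonneg[OF s, of "m+i"] one_plus_pos[OF s] by (simp add: T_def abs_mult)
    also have "\<dots> \<le> weight (m + i) 0 * B"
      using 1 B branch_mem[OF s, of "m+i"] weight_nonneg[of 0 "m+i"] by (intro mult_mono) auto
    finally show ?thesis .
  qed
  have Tint: "(T i has_integral integral {branch (Suc (m + i)) 0..branch (m + i) 0} F) {0..\<theta>}" for i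
    using branch_has_integral[OF f, of "m+i"] unfolding T_def F_def by simp
  have Tcont: "continuous_on {0..\<theta>} (T i)" for i
  proof -
    have d: "s + real (m + i) * \<theta> \<noteq> 0" "s + real (Suc (m + i)) * \<theta> \<noteq> 0" "1 + \<theta> * s \<noteq> 0" if "s \<in> {0..\<theta>}" for s
      using that denom_pos[of s "m+i"] denom_pos[of s "Suc (m+i)"] one_plus_pos[of s] by auto
    have "continuous_on {0..\<theta>} (branch (m + i))"
      unfolding branch_def using d by (intro continuous_intros) auto
    then have "continuous_on {0..\<theta>} (\<lambda>s. f (branch (m + i) s))"
      by (intro continuous_on_compose2[OF f]) (use branch_mem in auto)
    then show ?thesis unfolding T_def weight_def using d by (intro continuous_intros) auto
  qed
  have UT: "(\<Sum>i. T i s) = transition f s / (1 + \<theta> * s)" if "s \<in> {0..\<theta>}" for s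
    unfolding T_def transition_def using transition_abs_summable[of f B s, OF B] that by (intro suminf_divide) auto
  have lim: "uniform_limit {0..\<theta>} (\<lambda>n s. \<Sum>i<n. T i s) (\<lambda>s. \<Sum>i. T i s) sequentially"
    using weight_sums[of 0] by (intro Weierstrass_m_test[OF T_le] summable_mult2) (auto simp: sums_iff)
  have "continuous_on {0..\<theta>} (\<lambda>s. \<Sum>i. T i s)"
    by (rule uniform_limit_theorem[OF _ lim]) (auto intro!: always_eventually continuous_intros Tcont)
  then have "continuous_on {0..\<theta>} (\<lambda>s. (\<Sum>i. T i s) * (1 + \<theta> * s))" by (intro continuous_intros)
  moreover have "(\<Sum>i. T i s) * (1 + \<theta> * s) = transition f s" if "s \<in> {0..\<theta>}" for s
    using UT[OF that] one_plus_pos[of s] that by simp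
  ultimately show "continuous_on {0..\<theta>} (transition f)" by (metis (no_types, lifting) continuous_on_eq)
  obtain I J where I: "\<And>n. ((\<lambda>s. \<Sum>i<n. T i s) has_integral I n) {0..\<theta>}"
    and J: "((\<lambda>s. \<Sum>i. T i s) has_integral J) {0..\<theta>}" and IJ: "I \<longlonglongrightarrow> J"
    by (rule uniform_limit_integral[OF lim continuous_on_sum[OF Tcont] trivial_limit_sequentially]) blast
  have "I n = integral {branch (m + n) 0..\<theta>} F" for n
  proof -
    have "((\<lambda>s. \<Sum>i<n. T i s) has_integral (\<Sum>i<n. integral {branch (Suc (m + i)) 0..branch (m + i) 0} F)) {0..\<theta>}"
      by (intro has_integral_sum Tint) auto
    then show ?thesis using I[of n] sum_branch_integrals[OF F] by (auto dest: has_integral_unique)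
  qed
  also have "integral {branch (m + n) 0..\<theta>} F = integral {0..\<theta>} F - integral {0..branch (m + n) 0} F" for n
    using Henstock_Kurzweil_Integration.integral_combine[of 0 "branch (m+n) 0" \<theta> F]
      branch_mem[of 0 "m+n"] integrable_continuous_real[OF F] by simp
  finally have I_eq: "I = (\<lambda>n. integral {0..\<theta>} F - integral {0..branch (m + n) 0} F)" by auto
  have "((\<lambda>n. branch (m + n) 0) \<longlongrightarrow> 0) sequentially"
    unfolding branch_def using theta_pos by real_asymp
  then have "(\<lambda>n. integral {0..branch (m + n) 0} F) \<longlonglongrightarrow> integral {0..0} F"
    by (rule continuous_on_tendsto_compose[OF indefinite_integral_continuous_1[OF integrable_continuous_real[OF F]]])
       (use theta_pos branch_mem[of 0] in \<open>simp_all add: always_eventually\<close>)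
  then have "I \<longlonglongrightarrow> integral {0..\<theta>} F - 0"
    unfolding I_eq by (intro tendsto_diff tendsto_const) simp
  then have "J = integral {0..\<theta>} F" using IJ LIMSEQ_unique by fastforce
  moreover have "((\<lambda>s. transition f s / (1 + \<theta> * s)) has_integral J) {0..\<theta>}"
    using J UT by (metis (no_types, lifting) has_integral_eq)
  ultimately show "mean (transition f) = mean f" unfolding mean_def F_def by (auto simp: has_integral_iff)
qed

lemma mean_1: "mean (\<lambda>_. 1) = ln (1 + \<theta>\<^sup>2) / \<theta>"
proof -
  have "((\<lambda>s. 1 / (1 + \<theta> * s)) has_integral (ln (1 + \<theta> * \<theta>) / \<theta> - ln (1 + \<theta> * 0) / \<theta>)) {0..\<theta>}"
  proof (rule fundamental_theorem_of_calculus)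
    fix s assume "s \<in> {0..\<theta>}"
    then have "1 + \<theta> * s > 0" using one_plus_pos by simp
    then have "((\<lambda>s. ln (1 + \<theta> * s) / \<theta>) has_real_derivative 1 / (1 + \<theta> * s)) (at s within {0..\<theta>})"
      using theta_pos by (auto intro!: derivative_eq_intros)
    then show "((\<lambda>s. ln (1 + \<theta> * s) / \<theta>) has_vector_derivative 1 / (1 + \<theta> * s)) (at s within {0..\<theta>})"
      by (simp add: has_real_derivative_iff_has_vector_derivative)
  qed (use theta_pos in auto)
  then show ?thesis by (simp add: mean_def has_integral_iff power2_eq_square)
qed

lemma mean_iter_rate:
  "continuous_on {0..\<theta>} ((transition ^^ n) rate) \<and> mean ((transition ^^ n) rate) = 1 / \<theta>"
proof (induction n)
  case 0
  have "mean rate = integral {0..\<theta>} (\<lambda>s. 1 / \<theta>\<^sup>2)"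
    unfolding mean_def
  proof (rule integral_cong)
    fix s assume "s \<in> {0..\<theta>}"
    then show "rate s / (1 + \<theta> * s) = 1 / \<theta>\<^sup>2" using one_plus_pos[of s] by (simp add: rate_def)
  qed
  then have "mean rate = 1 / \<theta>" using theta_pos by (simp add: power2_eq_square)
  moreover have "continuous_on {0..\<theta>} rate"
    unfolding rate_def using theta_pos by (intro continuous_intros) auto
  ultimately show ?case by simp
qed (use mean_transition in auto)

lemma c_pos: "0 < c" and mean_1_c: "mean (\<lambda>_. 1) * c = 1 / \<theta>"
proof -
  have "0 < ln (1 + \<theta>\<^sup>2)" using theta_pos by (intro ln_gt_zero) auto
  then show "0 < c" "mean (\<lambda>_. 1) * c = 1 / \<theta>" by (auto simp: mean_1 c_def)
qed

lemma mean_mono: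
  assumes "continuous_on {0..\<theta>} f" "continuous_on {0..\<theta>} h" "\<And>s. s \<in> {0..\<theta>} \<Longrightarrow> f s \<le> h s"
  shows "mean f \<le> mean h"
proof -
  have "(\<lambda>s. k s / (1 + \<theta> * s)) integrable_on {0..\<theta>}" if "continuous_on {0..\<theta>} k" for k
    using that one_plus_pos by (intro integrable_continuous_real continuous_intros) force+
  then show ?thesis unfolding mean_def
    using assms one_plus_pos by (intro integral_le divide_right_mono) force+
qed

lemma mean_const: "mean (\<lambda>_. a) = a * mean (\<lambda>_. 1)"
  using integral_mult_right[of "{0..\<theta>}" a "\<lambda>s. 1 / (1 + \<theta> * s)"] by (simp add: mean_def)

text \<open>
  By invariance the mean of every iterate is that of the constant \<open>c\<close>, so \<open>c\<close> lies between the
  extreme values of the iterate, and these differ by at most the oscillation.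
\<close>
lemma transition_iter_rate_limit:
  assumes s: "s \<in> {0..\<theta>}"
  shows "\<bar>(transition ^^ n) rate s - c\<bar> \<le> 18 / 2 ^ n"
proof -
  let ?r = "(transition ^^ n) rate" and ?e = "18 / 2 ^ n :: real"
  have cont: "continuous_on {0..\<theta>} ?r" and mean: "mean ?r = c * mean (\<lambda>_. 1)"
    using mean_iter_rate[of n] mean_1_c by (simp_all add: mult.commute)
  have pos: "mean (\<lambda>_. 1) > 0" using mean_1_c c_pos theta_pos
    by (metis divide_pos_pos zero_less_mult_pos2 zero_less_one)
  have osc: "\<bar>?r t - ?r s\<bar> \<le> ?e" if "t \<in> {0..\<theta>}" for t using transition_iter_rate_osc[OF s that] .
  have "?r s - ?e \<le> ?r t" "?r t \<le> ?r s + ?e" if "t \<in> {0..\<theta>}" for t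
    using osc[OF that] by auto
  then have "mean (\<lambda>_. ?r s - ?e) \<le> mean ?r" "mean ?r \<le> mean (\<lambda>_. ?r s + ?e)"
    using cont by (auto intro!: mean_mono)
  then have "(?r s - ?e) * mean (\<lambda>_. 1) \<le> c * mean (\<lambda>_. 1)" "c * mean (\<lambda>_. 1) \<le> (?r s + ?e) * mean (\<lambda>_. 1)"
    unfolding mean by (metis mean_const)+
  then show ?thesis using pos by simp
qed

section \<open>Conditional laws of the iterates\<close>

definition law_density :: "real \<Rightarrow> real \<Rightarrow> real" where
  "law_density s x = (1 + \<theta> * s) / (\<theta> * (1 + s * x)\<^sup>2)"

text \<open>
  The law of \<open>x\<close> for a chain started in state \<open>s\<close>; the uniform distribution belongs to \<open>s = 0\<close>.
  The end points are left out so that every inverse branch maps the support into itself and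
  \<open>first_digit_branch\<close> applies to all its points.
\<close>
definition law :: "real \<Rightarrow> real measure" where
  "law s = density lborel (\<lambda>x. indicator {0<..<\<theta>} x * ennreal (law_density s x))"

lemma law_density_measurable [measurable]: "law_density s \<in> borel_measurable borel"
  unfolding law_density_def by measurable

lemma sets_law [measurable_cong, simp]: "sets (law s) = sets borel"
  and space_law [simp]: "space (law s) = UNIV"
  by (simp_all add: law_def)

lemma law_AE: "AE x in law s. x \<in> {0<..<\<theta>} \<and> x \<noteq> a"
proof -
  have "AE x in law s. x \<in> {0<..<\<theta>}"
    unfolding law_def by (subst AE_density) (auto simp: indicator_def)
  moreover have "AE x in law s. x \<noteq> a"
    unfolding law_def using AE_lborel_singleton[of a] by (subst AE_density) auto
  ultimately show ?thesis by auto
qed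

lemma prob_space_law:
  assumes s: "s \<in> {0..\<theta>}" shows "prob_space (law s)"
proof (rule prob_spaceI)
  have pos: "1 + s * x > 0" if "x \<in> {0..\<theta>}" for x using s that by (auto intro: add_pos_nonneg)
  have "emeasure (law s) (space (law s)) = (\<integral>\<^sup>+x. indicator {0<..<\<theta>} x * ennreal (law_density s x) \<partial>lborel)"
    unfolding law_def by (subst emeasure_density) auto
  also have "\<dots> = (\<integral>\<^sup>+x. ennreal (law_density s x) * indicator {0..\<theta>} x \<partial>lborel)"
  proof (rule nn_integral_cong_AE)
    show "AE x in lborel. indicator {0<..<\<theta>} x * ennreal (law_density s x) = ennreal (law_density s x) * indicator {0..\<theta>} x"
      using AE_lborel_singleton[of 0] AE_lborel_singleton[of \<theta>]
      by eventually_elim (auto simp: indicator_def)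
  qed
  also have "\<dots> = ennreal ((1 + \<theta> * s) * \<theta> / (\<theta> * (1 + s * \<theta>)) - (1 + \<theta> * s) * 0 / (\<theta> * (1 + s * 0)))"
  proof (rule nn_integral_FTC_Icc)
    fix x assume "x \<in> {0..\<theta>}"
    then have p: "1 + s * x > 0" using pos by simp
    show "((\<lambda>x. (1 + \<theta> * s) * x / (\<theta> * (1 + s * x))) has_real_derivative law_density s x) (at x)"
      unfolding law_density_def using p theta_pos
      by (auto intro!: derivative_eq_intros simp: power2_eq_square divide_simps) (simp add: algebra_simps)
    show "0 \<le> law_density s x" using s theta_pos by (auto simp: law_density_def)
  qed (use theta_pos in auto)
  also have "\<dots> = 1" using theta_pos pos[of \<theta>] s by (simp add: mult.commute)
  finally show "emeasure (law s) (space (law s)) = 1" .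
qed

lemma branch_measurable [measurable]: "branch k \<in> borel_measurable borel"
  unfolding branch_def by measurable

text \<open>
  The Markov property at the level of densities: pulling the density for \<open>s\<close> back along \<open>branch k\<close>
  gives the density for \<open>branch k s\<close>, and the factor is the probability of the digit \<open>k\<close>.
\<close>
lemma branch_density:
  assumes s: "s \<in> {0..\<theta>}" and k: "m \<le> k" and y: "0 \<le> y"
  shows "law_density s (branch k y) / (y + real k * \<theta>)\<^sup>2 = weight k s * law_density (branch k s) y"
proof -
  define d e where "d = y + real k * \<theta>" and "e = s + real k * \<theta>"
  have d: "d > 0" and e: "e > 0" using denom_pos[OF y k] denom_pos[of s k] s k by (simp_all add: d_def e_def)
  have e\<theta>: "e + \<theta> > 0" and ey: "e + y > 0" using e theta_pos y by auto
  have ds: "d + s = e + y" by (simp add: d_def e_def)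
  have 1: "law_density s (branch k y) = (1 + \<theta> * s) * d\<^sup>2 / (\<theta> * (e + y)\<^sup>2)"
    unfolding law_density_def branch_def d_def[symmetric] ds[symmetric]
    using d by (simp add: power2_eq_square divide_simps)
  have 2: "law_density (branch k s) y = (e + \<theta>) * e / (\<theta> * (e + y)\<^sup>2)"
    unfolding law_density_def branch_def e_def[symmetric]
    using e ey by (simp add: power2_eq_square divide_simps)
  have 3: "weight k s = (1 + \<theta> * s) / (e * (e + \<theta>))"
    by (simp add: weight_def e_def algebra_simps)
  show ?thesis unfolding 1 2 3 d_def[symmetric] using d e e\<theta> by simp
qed

lemma law_branch:
  assumes s: "s \<in> {0..\<theta>}" and k: "m \<le> k" and A [measurable]: "A \<in> sets borel"
  shows "emeasure (law s) (A \<inter> {branch (Suc k) 0..branch k 0})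
    = ennreal (weight k s) * emeasure (law (branch k s)) {y. branch k y \<in> A}"
proof -
  define f where "f x = ennreal (law_density s x) * indicator A x" for x
  have [measurable]: "f \<in> borel_measurable borel" unfolding f_def by measurable
  have den: "\<theta> - t + real k * \<theta> > 0" if "t \<in> {0..\<theta>}" for t using denom_pos[of "\<theta> - t" k] that k by simp
  have range: "0 < branch (Suc k) 0" "branch k 0 \<le> \<theta>"
    using branch_mem[of 0 k] k denom_pos[of 0 "Suc k"] by (auto simp: branch_def)
  have "emeasure (law s) (A \<inter> {branch (Suc k) 0..branch k 0}) =
    (\<integral>\<^sup>+x. (indicator {0<..<\<theta>} x * ennreal (law_density s x)) * indicator (A \<inter> {branch (Suc k) 0..branch k 0}) x \<partial>lborel)"
    unfolding law_def by (subst emeasure_density) auto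
  also have "\<dots> = (\<integral>\<^sup>+x. f x * indicator {branch (Suc k) 0..branch k 0} x \<partial>lborel)"
  proof (rule nn_integral_cong_AE)
    show "AE x in lborel. (indicator {0<..<\<theta>} x * ennreal (law_density s x)) * indicator (A \<inter> {branch (Suc k) 0..branch k 0}) x
      = f x * indicator {branch (Suc k) 0..branch k 0} x"
      using AE_lborel_singleton[of \<theta>]
      by eventually_elim (use range in \<open>auto simp: f_def indicator_def\<close>)
  qed
  also have "\<dots> = (\<integral>\<^sup>+x. f x * indicator {branch k (\<theta> - 0)..branch k (\<theta> - \<theta>)} x \<partial>lborel)"
    by (simp add: branch_theta)
  also have "\<dots> = (\<integral>\<^sup>+t. f (branch k (\<theta> - t)) * ennreal (1 / (\<theta> - t + real k * \<theta>)\<^sup>2) * indicator {0..\<theta>} t \<partial>lborel)"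
  proof (rule nn_integral_substitution_aux)
    show "((\<lambda>t. branch k (\<theta> - t)) has_real_derivative 1 / (\<theta> - t + real k * \<theta>)\<^sup>2) (at t)"
      if "t \<in> {0..\<theta>}" for t
      unfolding branch_def using den[OF that]
      by (auto intro!: derivative_eq_intros simp: power2_eq_square)
    show "continuous_on {0..\<theta>} (\<lambda>t. 1 / (\<theta> - t + real k * \<theta>)\<^sup>2)"
      using den by (intro continuous_intros) force
  qed (use theta_pos in auto)
  also have "\<dots> = (\<integral>\<^sup>+y. f (branch k (\<theta> - (\<theta> + (-1) * y))) * ennreal (1 / (\<theta> - (\<theta> + (-1) * y) + real k * \<theta>)\<^sup>2)
      * indicator {0..\<theta>} (\<theta> + (-1) * y) \<partial>lborel)"
    by (subst nn_integral_real_affine[of _ "-1" \<theta>]) auto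
  also have "\<dots> = (\<integral>\<^sup>+y. ennreal (weight k s) * ((indicator {0<..<\<theta>} y * ennreal (law_density (branch k s) y))
      * indicator {y. branch k y \<in> A} y) \<partial>lborel)"
  proof (rule nn_integral_cong_AE)
    show "AE y in lborel. f (branch k (\<theta> - (\<theta> + (-1) * y))) * ennreal (1 / (\<theta> - (\<theta> + (-1) * y) + real k * \<theta>)\<^sup>2)
      * indicator {0..\<theta>} (\<theta> + (-1) * y) = ennreal (weight k s) * ((indicator {0<..<\<theta>} y * ennreal (law_density (branch k s) y))
      * indicator {y. branch k y \<in> A} y)"
      using AE_lborel_singleton[of 0] AE_lborel_singleton[of \<theta>]
    proof eventually_elim
      case (elim y)
      show ?case
      proof (cases "y \<in> {0<..<\<theta>}")
        case True
        have "0 \<le> law_density s (branch k y)" using s theta_pos by (simp add: law_density_def)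
        then have "ennreal (law_density s (branch k y)) * ennreal (1 / (y + real k * \<theta>)\<^sup>2)
          = ennreal (law_density s (branch k y) / (y + real k * \<theta>)\<^sup>2)"
          by (simp add: ennreal_mult[symmetric])
        also have "\<dots> = ennreal (weight k s) * ennreal (law_density (branch k s) y)"
          using branch_density[OF s k, of y] True weight_nonneg[of s k] s k
            branch_mem[of s k] theta_pos
          by (simp add: ennreal_mult[symmetric] law_density_def)
        finally show ?thesis using True by (auto simp: f_def indicator_def mult_ac)
      qed (use elim in \<open>auto simp: indicator_def\<close>)
    qed
  qed
  also have "\<dots> = ennreal (weight k s) * (\<integral>\<^sup>+y. ((indicator {0<..<\<theta>} y * ennreal (law_density (branch k s) y))
      * indicator {y. branch k y \<in> A} y) \<partial>lborel)"
    by (rule nn_integral_cmult) measurable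
  also have "\<dots> = ennreal (weight k s) * emeasure (law (branch k s)) {y. branch k y \<in> A}"
    unfolding law_def by (subst emeasure_density) auto
  finally show ?thesis .
qed

lemma first_digit_branch:
  assumes y: "0 \<le> y" "y < \<theta>" and k: "m \<le> k"
  shows "first_digit \<theta> (branch k y) = enat k" "theta_map \<theta> (branch k y) = y"
proof -
  have d: "y + real k * \<theta> > 0" using denom_pos[of y k] y k by simp
  have "1 / (branch k y * \<theta>) = y / \<theta> + real k" using d theta_pos by (simp add: branch_def field_simps)
  moreover have "\<lfloor>y / \<theta> + real k\<rfloor> = int k" using y theta_pos by (simp add: floor_eq_iff)
  ultimately have fl: "\<lfloor>1 / (branch k y * \<theta>)\<rfloor> = int k" by simp
  have "branch k y \<noteq> 0" using d by (simp add: branch_def)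
  then show "first_digit \<theta> (branch k y) = enat k" "theta_map \<theta> (branch k y) = y"
    using fl by (auto simp: first_digit_def theta_map_def branch_def algebra_simps)
qed

lemma first_digit_cases:
  assumes x: "0 < x" "x < \<theta>"
  obtains i where "first_digit \<theta> x = enat (m + i)"
proof -
  have "real m = 1 / (\<theta> * \<theta>)" using m_theta theta_pos by (simp add: field_simps)
  also have "\<dots> \<le> 1 / (x * \<theta>)" using x theta_pos by (intro divide_left_mono) auto
  finally have "int m \<le> \<lfloor>1 / (x * \<theta>)\<rfloor>" by (simp add: le_floor_iff)
  then have "first_digit \<theta> x = enat (m + (nat \<lfloor>1 / (x * \<theta>)\<rfloor> - m))" using x by (simp add: first_digit_def)
  then show ?thesis by (rule that)
qed

lemma first_digit_interval:
  assumes x: "0 < x" and k: "m \<le> k"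
  shows "first_digit \<theta> x = enat k \<longleftrightarrow> x \<in> {branch (Suc k) 0<..branch k 0}"
proof -
  have k0: "real k > 0" using k m_pos by simp
  have "first_digit \<theta> x = enat k \<longleftrightarrow> \<lfloor>1 / (x * \<theta>)\<rfloor> = int k"
    using x k0 by (auto simp: first_digit_def)
  also have "\<dots> \<longleftrightarrow> real k \<le> 1 / (x * \<theta>) \<and> 1 / (x * \<theta>) < real (Suc k)" by (simp add: floor_eq_iff add.commute)
  also have "real k \<le> 1 / (x * \<theta>) \<longleftrightarrow> x \<le> branch k 0"
    using x k0 theta_pos by (simp add: branch_def field_simps)
  also have "1 / (x * \<theta>) < real (Suc k) \<longleftrightarrow> branch (Suc k) 0 < x"
    using x k0 theta_pos unfolding branch_def by (simp add: pos_divide_less_eq mult_ac)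
  finally show ?thesis by auto
qed

lemma theta_map_measurable [measurable]: "theta_map \<theta> \<in> borel_measurable borel"
  unfolding theta_map_def by measurable

lemma first_digit_measurable [measurable]: "first_digit \<theta> \<in> borel \<rightarrow>\<^sub>M count_space UNIV"
  unfolding first_digit_def by measurable

text \<open>
  Up to a null set of end points, the intervals of constant first digit tile the support,
  and \<open>law_branch\<close> treats each of them.
\<close>
lemma law_decomp:
  assumes s: "s \<in> {0..\<theta>}" and A [measurable]: "A \<in> sets borel"
  shows "emeasure (law s) A = (\<Sum>i. ennreal (weight (m + i) s) *
    emeasure (law (branch (m + i) s)) {y. branch (m + i) y \<in> A})"
proof -
  define J where "J i = A \<inter> {x. first_digit \<theta> x = enat (m + i)}" for i
  have J [measurable]: "J i \<in> sets borel" for i unfolding J_def by measurable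
  have "emeasure (law s) A = emeasure (law s) (\<Union>i. J i)"
  proof (rule emeasure_eq_AE)
    show "AE x in law s. x \<in> A \<longleftrightarrow> x \<in> (\<Union>i. J i)"
      using law_AE[of 0 s]
    proof eventually_elim
      case (elim x)
      then show ?case using first_digit_cases[of x] by (auto simp: J_def)
    qed
  qed auto
  also have "\<dots> = (\<Sum>i. emeasure (law s) (J i))"
    by (rule suminf_emeasure[symmetric]) (auto simp: disjoint_family_on_def J_def)
  also have "\<dots> = (\<Sum>i. ennreal (weight (m + i) s) *
    emeasure (law (branch (m + i) s)) {y. branch (m + i) y \<in> A})"
  proof (rule suminf_cong)
    fix i
    have "emeasure (law s) (J i) = emeasure (law s) (A \<inter> {branch (Suc (m + i)) 0..branch (m + i) 0})"
    proof (rule emeasure_eq_AE)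
      show "AE x in law s. x \<in> J i \<longleftrightarrow> x \<in> A \<inter> {branch (Suc (m + i)) 0..branch (m + i) 0}"
        using law_AE[of "branch (Suc (m + i)) 0" s]
      proof eventually_elim
        case (elim x)
        then show ?case using first_digit_interval[of x "m+i"] by (auto simp: J_def)
      qed
    qed auto
    then show "emeasure (law s) (J i) = ennreal (weight (m + i) s) *
      emeasure (law (branch (m + i) s)) {y. branch (m + i) y \<in> A}"
      using law_branch[OF s _ A, of "m+i"] by simp
  qed
  finally show ?thesis .
qed

lemma law_step:
  assumes s: "s \<in> {0..\<theta>}"
    and [measurable]: "{x. R (first_digit \<theta> x) (theta_map \<theta> x)} \<in> sets borel" "\<And>d. {y. R d y} \<in> sets borel"
  shows "emeasure (law s) {x. R (first_digit \<theta> x) (theta_map \<theta> x)} = (\<Sum>i. ennreal (weight (m + i) s) *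
    emeasure (law (branch (m + i) s)) {y. R (enat (m + i)) y})"
proof -
  have "emeasure (law t) {y. branch k y \<in> {x. R (first_digit \<theta> x) (theta_map \<theta> x)}}
    = emeasure (law t) {y. R (enat k) y}" if "m \<le> k" for t k
  proof (rule emeasure_eq_AE)
    show "AE y in law t. y \<in> {y. branch k y \<in> {x. R (first_digit \<theta> x) (theta_map \<theta> x)}} \<longleftrightarrow> y \<in> {y. R (enat k) y}"
      using law_AE[of 0 t] by eventually_elim (use first_digit_branch that in auto)
    show "{y. branch k y \<in> {x. R (first_digit \<theta> x) (theta_map \<theta> x)}} \<in> sets (law t)"
      using measurable_sets[OF branch_measurable[of k] assms(2)] by (simp add: vimage_def)
  qed auto
  then show ?thesis by (subst law_decomp[OF s assms(2)]) simp
qed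

fun digits :: "nat \<Rightarrow> real \<Rightarrow> enat list" where
  "digits 0 x = []"
| "digits (Suc n) x = first_digit \<theta> x # digits n (theta_map \<theta> x)"

lemma set_digits: "set (digits n x) = (\<lambda>k. theta_digit \<theta> k x) ` {1..n}"
proof (induction n arbitrary: x)
  case (Suc n)
  have "{1..Suc n} = insert 1 (Suc ` {1..n})"
    by (simp add: atLeastAtMost_insertL image_Suc_atLeastAtMost)
  moreover have "theta_digit \<theta> (Suc k) x = theta_digit \<theta> k (theta_map \<theta> x)" if "k \<in> {1..n}" for k
    using that by (cases k) (auto simp: theta_digit_def funpow_Suc_right simp del: funpow.simps)
  then have "(\<lambda>k. theta_digit \<theta> (Suc k) x) ` {1..n} = set (digits n (theta_map \<theta> x))"
    unfolding Suc by (rule image_cong[OF refl])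
  moreover have "theta_digit \<theta> 1 x = first_digit \<theta> x" by (simp add: theta_digit_def)
  ultimately show ?case by (simp only: image_insert image_image digits.simps list.set)
qed simp

lemma digits_append: "digits (n + k) x = digits n x @ digits k ((theta_map \<theta> ^^ n) x)"
  by (induction n arbitrary: x) (simp_all add: funpow_Suc_right del: funpow.simps(2))

lemma digits_sets: "{x. P (digits n x)} \<in> sets borel"
proof (induction n arbitrary: P)
  case (Suc n)
  have "{x. P (digits (Suc n) x)} =
    (\<Union>d. {x. first_digit \<theta> x = d} \<inter> (theta_map \<theta> -` {x. P (d # digits n x)} \<inter> space borel))"
    by auto
  also have "\<dots> \<in> sets borel"
  proof (rule sets.countable_UN''[OF countableI_type], rule sets.Int)
    fix d
    show "theta_map \<theta> -` {x. P (d # digits n x)} \<inter> space borel \<in> sets borel"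
      by (intro measurable_sets[OF theta_map_measurable] Suc)
    show "{x. first_digit \<theta> x = d} \<in> sets borel" by measurable
  qed
  finally show ?case .
qed simp

lemma theta_map_iter_measurable [measurable]: "(theta_map \<theta> ^^ n) \<in> borel_measurable borel"
  by (induction n) (auto simp: id_def[symmetric])

text \<open>
  A form of the Markov property that is enough for estimates: if an event has probability at most
  \<open>q\<close> from every state, it keeps this bound conditionally on any event that concerns the first
  \<open>n\<close> digits.
\<close>
lemma past_future:
  assumes B [measurable]: "B \<in> sets borel"
    and q: "\<And>s. s \<in> {0..\<theta>} \<Longrightarrow> emeasure (law s) B \<le> q"
  shows "s \<in> {0..\<theta>} \<Longrightarrow>
    emeasure (law s) {x. P (digits n x) \<and> (theta_map \<theta> ^^ n) x \<in> B}
      \<le> q * emeasure (law s) {x. P (digits n x)}"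
proof (induction n arbitrary: s P)
  case 0
  interpret prob_space "law s" using 0 by (rule prob_space_law)
  show ?case using q[OF 0] emeasure_space_1 by (cases "P []") auto
next
  case (Suc n)
  have [measurable]: "{x. P (digits k x) \<and> (theta_map \<theta> ^^ k) x \<in> B} \<in> sets borel" for P k
    using sets.Int[OF digits_sets[of P k] measurable_sets[OF theta_map_iter_measurable B], of k]
    by (simp add: vimage_def Int_def)
  have eq: "(P (digits (Suc n) x) \<and> (theta_map \<theta> ^^ Suc n) x \<in> B) =
     (P (first_digit \<theta> x # digits n (theta_map \<theta> x)) \<and> (theta_map \<theta> ^^ n) (theta_map \<theta> x) \<in> B)" for x
    by (simp add: funpow_swap1)
  have "emeasure (law s) {x. P (digits (Suc n) x) \<and> (theta_map \<theta> ^^ Suc n) x \<in> B}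
    = (\<Sum>i. ennreal (weight (m + i) s) * emeasure (law (branch (m + i) s))
        {y. P (enat (m + i) # digits n y) \<and> (theta_map \<theta> ^^ n) y \<in> B})"
    unfolding eq
    by (rule law_step[OF Suc.prems, of "\<lambda>d y. P (d # digits n y) \<and> (theta_map \<theta> ^^ n) y \<in> B"])
      (unfold eq[symmetric], measurable)
  also have "\<dots> \<le> (\<Sum>i. q * (ennreal (weight (m + i) s) * emeasure (law (branch (m + i) s))
        {y. P (enat (m + i) # digits n y)}))"
  proof (rule suminf_le)
    fix i
    have "branch (m + i) s \<in> {0..\<theta>}" using Suc.prems by (intro branch_mem) auto
    from mult_left_mono[OF Suc.IH[OF this, of "\<lambda>l. P (enat (m + i) # l)"], of "ennreal (weight (m + i) s)"]
    show "ennreal (weight (m + i) s) * emeasure (law (branch (m + i) s))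
        {y. P (enat (m + i) # digits n y) \<and> (theta_map \<theta> ^^ n) y \<in> B}
      \<le> q * (ennreal (weight (m + i) s) * emeasure (law (branch (m + i) s)) {y. P (enat (m + i) # digits n y)})"
      by (simp add: mult_ac)
  qed auto
  also have "\<dots> = q * emeasure (law s) {x. P (digits (Suc n) x)}"
    unfolding ennreal_suminf_cmult digits.simps
    by (subst law_step[OF Suc.prems, of "\<lambda>d y. P (d # digits n y)"])
       (use digits_sets[of P "Suc n"] digits_sets in auto)
  finally show ?case .
qed

section \<open>Survival probabilities\<close>

definition survival :: "nat \<Rightarrow> nat \<Rightarrow> real \<Rightarrow> real" where
  "survival K n s = measure (law s) {x. \<forall>d\<in>set (digits n x). d < enat K}"

lemma survival_0: "s \<in> {0..\<theta>} \<Longrightarrow> survival K 0 s = 1"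
  using prob_space.prob_space[OF prob_space_law, of s] by (simp add: survival_def)

lemma survival_nonneg: "0 \<le> survival K n s"
  by (simp add: survival_def)

lemma survival_Suc:
  assumes s: "s \<in> {0..\<theta>}"
  shows "survival K (Suc n) s = (\<Sum>i<K - m. weight (m + i) s * survival K n (branch (m + i) s))"
proof -
  have fin: "emeasure (law t) A = ennreal (measure (law t) A)" if "t \<in> {0..\<theta>}" for t A
    using prob_space_law[OF that] by (intro finite_measure.emeasure_eq_measure prob_space.axioms(1))
  have s0: "0 \<le> s" using s by simp
  note b = branch_mem[OF s0]
  let ?R = "\<lambda>d y. d < enat K \<and> (\<forall>d\<in>set (digits n y). d < enat K)"
  have eq: "{x. \<forall>d\<in>set (digits (Suc n) x). d < enat K} = {x. ?R (first_digit \<theta> x) (theta_map \<theta> x)}"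
    by auto
  have R1: "{x. ?R (first_digit \<theta> x) (theta_map \<theta> x)} \<in> sets borel"
    unfolding eq[symmetric] by (rule digits_sets[of "\<lambda>l. \<forall>d\<in>set l. d < enat K"])
  have R2: "{y. ?R d y} \<in> sets borel" for d
    by (rule digits_sets[of "\<lambda>l. d < enat K \<and> (\<forall>e\<in>set l. e < enat K)"])
  have "emeasure (law s) {x. \<forall>d\<in>set (digits (Suc n) x). d < enat K} = (\<Sum>i. ennreal (weight (m + i) s) * emeasure (law (branch (m + i) s)) {y. ?R (enat (m + i)) y})"
    unfolding eq by (rule law_step[OF s R1 R2])
  also have "\<dots> = (\<Sum>i<K - m. ennreal (weight (m + i) s) * emeasure (law (branch (m + i) s)) {y. ?R (enat (m + i)) y})"
  proof (rule suminf_finite)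
    fix i assume "i \<notin> {..<K - m}"
    then have "{y. ?R (enat (m + i)) y} = {}" by auto
    then show "ennreal (weight (m + i) s) * emeasure (law (branch (m + i) s)) {y. ?R (enat (m + i)) y} = 0"
      by (simp only: emeasure_empty mult_zero_right)
  qed simp
  also have "\<dots> = (\<Sum>i<K - m. ennreal (weight (m + i) s * survival K n (branch (m + i) s)))"
  proof (rule sum.cong)
    fix i assume "i \<in> {..<K - m}"
    then have "{y. ?R (enat (m + i)) y} = {y. \<forall>d\<in>set (digits n y). d < enat K}" by auto
    then show "ennreal (weight (m + i) s) * emeasure (law (branch (m + i) s)) {y. ?R (enat (m + i)) y}
      = ennreal (weight (m + i) s * survival K n (branch (m + i) s))"
      using fin[OF b] weight_nonneg[OF s0, of "m+i"] survival_nonneg by (simp add: survival_def ennreal_mult)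
  qed simp
  also have "\<dots> = ennreal (\<Sum>i<K - m. weight (m + i) s * survival K n (branch (m + i) s))"
    using weight_nonneg[OF s0] survival_nonneg by (intro sum_ennreal) simp
  finally have "ennreal (survival K (Suc n) s) = ennreal (\<Sum>i<K - m. weight (m + i) s * survival K n (branch (m + i) s))"
    using fin[OF s] by (simp add: survival_def)
  then show ?thesis
    using weight_nonneg[OF s0] survival_nonneg by (subst (asm) ennreal_inj) (auto intro!: sum_nonneg)
qed

text \<open>
  By \<open>survival_Suc\<close>, survival probabilities are iterates of the killed operator applied to the
  constant \<open>1\<close>. A subsolution \<open>f \<le> 1\<close> for the factor \<open>l\<close> stays below them.
\<close>
lemma survival_ge_power:
  assumes "0 \<le> l" and f1: "\<And>t. t \<in> {0..\<theta>} \<Longrightarrow> f t \<le> 1"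
    and step: "\<And>t. t \<in> {0..\<theta>} \<Longrightarrow> l * f t \<le> (\<Sum>i<K - m. weight (m + i) t * f (branch (m + i) t))"
  shows "s \<in> {0..\<theta>} \<Longrightarrow> l ^ n * f s \<le> survival K n s"
proof (induction n arbitrary: s)
  case (Suc n)
  have s0: "0 \<le> s" using Suc by simp
  have "l ^ Suc n * f s = l ^ n * (l * f s)" by simp
  also have "\<dots> \<le> l ^ n * (\<Sum>i<K - m. weight (m + i) s * f (branch (m + i) s))"
    using step[OF Suc.prems] \<open>0 \<le> l\<close> by (intro mult_left_mono) auto
  also have "\<dots> = (\<Sum>i<K - m. weight (m + i) s * (l ^ n * f (branch (m + i) s)))"
    by (simp add: sum_distrib_left mult_ac)
  also have "\<dots> \<le> survival K (Suc n) s"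
    unfolding survival_Suc[OF Suc.prems]
    using branch_mem[OF s0] weight_nonneg[OF s0] by (intro sum_mono mult_left_mono Suc.IH) simp_all
  finally show ?case .
qed (simp add: f1 survival_0)

text \<open>
  The matching comparison with a supersolution \<open>f \<ge> 1\<close>.
\<close>
lemma survival_le_power:
  assumes "0 \<le> l" and f1: "\<And>t. t \<in> {0..\<theta>} \<Longrightarrow> 1 \<le> f t"
    and step: "\<And>t. t \<in> {0..\<theta>} \<Longrightarrow> (\<Sum>i<K - m. weight (m + i) t * f (branch (m + i) t)) \<le> l * f t"
  shows "s \<in> {0..\<theta>} \<Longrightarrow> survival K n s \<le> l ^ n * f s"
proof (induction n arbitrary: s)
  case (Suc n)
  have s0: "0 \<le> s" using Suc by simp
  have "survival K (Suc n) s \<le> (\<Sum>i<K - m. weight (m + i) s * (l ^ n * f (branch (m + i) s)))"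
    unfolding survival_Suc[OF Suc.prems]
    using branch_mem[OF s0] weight_nonneg[OF s0] by (intro sum_mono mult_left_mono Suc.IH) simp_all
  also have "\<dots> = l ^ n * (\<Sum>i<K - m. weight (m + i) s * f (branch (m + i) s))"
    by (simp add: sum_distrib_left mult_ac)
  also have "\<dots> \<le> l ^ n * (l * f s)"
    using step[OF Suc.prems] \<open>0 \<le> l\<close> by (intro mult_left_mono) auto
  finally show ?case by (simp add: mult_ac)
qed (simp add: f1 survival_0)

lemma transition_partial_le:
  assumes "\<And>t. t \<in> {0..\<theta>} \<Longrightarrow> 0 \<le> f t" "\<And>t. t \<in> {0..\<theta>} \<Longrightarrow> f t \<le> B" "0 \<le> s"
  shows "(\<Sum>i<n. weight (m + i) s * f (branch (m + i) s)) \<le> transition f s"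
  unfolding transition_def
proof (rule sum_le_suminf)
  show "summable (\<lambda>i. weight (m + i) s * f (branch (m + i) s))"
    using assms by (intro transition_abs_summable[of f B]) (auto simp: abs_le_iff intro: order_trans)
qed (use assms branch_mem[OF assms(3)] weight_nonneg[OF assms(3)] in auto)

lemma transition_sum_iterates:
  assumes "0 \<le> s"
  shows "transition (\<lambda>t. \<Sum>j<n. (transition ^^ j) rate t) s = (\<Sum>j<n. (transition ^^ Suc j) rate s)"
proof (induction n)
  case 0
  show ?case using assms by (simp add: transition_const)
next
  case (Suc n)
  have r: "\<bar>(transition ^^ j) rate t\<bar> \<le> real m + 1" if "t \<in> {0..\<theta>}" for j t
    using transition_iter_rate(1)[OF that, of j] by simp
  have "\<bar>\<Sum>j<n. (transition ^^ j) rate t\<bar> \<le> real n * (real m + 1)" if "t \<in> {0..\<theta>}" for t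
    using sum_norm_bound[of "{..<n}" "\<lambda>j. (transition ^^ j) rate t" "real m + 1"] r[OF that] by simp
  from transition_add_scaled[of "\<lambda>t. \<Sum>j<n. (transition ^^ j) rate t" _ "(transition ^^ n) rate" _ s 1 1, OF this r assms]
  show ?case using Suc by simp
qed

text \<open>
  The lower bound uses \<open>s \<le> \<theta>\<close>: the denominator \<open>s + K \<theta>\<close> is at most \<open>(K + 1) \<theta>\<close>.
\<close>
lemma tail_rate:
  assumes s: "s \<in> {0..\<theta>}" and K: "0 < K"
  shows "tail K s \<le> rate s / real K" "rate s / (real K + 1) \<le> tail K s"
proof -
  have num: "0 \<le> 1 + \<theta> * s" using one_plus_pos[of s] s by simp
  have K\<theta>: "real K * \<theta> > 0" using K theta_pos by simp
  have r: "rate s / k = (1 + \<theta> * s) / (\<theta> * (k * \<theta>))" for k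
    by (simp add: rate_def power2_eq_square mult_ac)
  show "tail K s \<le> rate s / real K"
    unfolding tail_def r using num K K\<theta> theta_pos s
    by (intro divide_left_mono mult_left_mono mult_pos_pos) (auto intro: add_nonneg_pos)
  show "rate s / (real K + 1) \<le> tail K s"
    unfolding tail_def r using num K K\<theta> theta_pos s
    by (intro divide_left_mono mult_left_mono mult_pos_pos) (auto simp: algebra_simps intro: add_nonneg_pos)
qed

text \<open>
  With \<open>w\<close> the sum of the first \<open>n\<close> iterates of \<open>rate\<close>, the combination \<open>rate + transition w - w\<close>
  telescopes to the \<open>n\<close>-th iterate, which is close to \<open>c\<close> by \<open>transition_iter_rate_limit\<close>.
\<close>
lemma corrector:
  assumes "0 < \<epsilon>"
  obtains w W where "0 \<le> W" "\<And>t. t \<in> {0..\<theta>} \<Longrightarrow> 0 \<le> w t" "\<And>t. t \<in> {0..\<theta>} \<Longrightarrow> w t \<le> W"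
    "\<And>t. t \<in> {0..\<theta>} \<Longrightarrow> \<bar>rate t + transition w t - w t - c\<bar> \<le> \<epsilon>"
proof -
  have "(\<lambda>n. 18 / 2 ^ n :: real) \<longlonglongrightarrow> 0" by real_asymp
  then have "eventually (\<lambda>n. 18 / 2 ^ n < \<epsilon>) sequentially" using assms by (rule order_tendstoD)
  then obtain n where n: "18 / 2 ^ n < \<epsilon>" by (auto simp: eventually_sequentially)
  define w where "w t = (\<Sum>j<n. (transition ^^ j) rate t)" for t
  have "0 \<le> w t" if "t \<in> {0..\<theta>}" for t
    unfolding w_def using transition_iter_rate(1)[OF that] by (intro sum_nonneg) auto
  moreover have "w t \<le> real n * (real m + 1)" if "t \<in> {0..\<theta>}" for t
    unfolding w_def using sum_bounded_above[of "{..<n}" "\<lambda>j. (transition ^^ j) rate t" "real m + 1"]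
      transition_iter_rate(1)[OF that] by simp
  moreover have "\<bar>rate t + transition w t - w t - c\<bar> \<le> \<epsilon>" if "t \<in> {0..\<theta>}" for t
  proof -
    have "transition w t = (\<Sum>j<n. (transition ^^ Suc j) rate t)"
      unfolding w_def using that by (intro transition_sum_iterates) simp
    then have "rate t + transition w t = (\<Sum>j<Suc n. (transition ^^ j) rate t)"
      by (subst sum.lessThan_Suc_shift) simp
    then have "rate t + transition w t - w t = (transition ^^ n) rate t" by (simp add: w_def)
    then show ?thesis using transition_iter_rate_limit[OF that, of n] n by simp
  qed
  ultimately show thesis by (intro that[of "real n * (real m + 1)" w]) auto
qed

text \<open>
  The function \<open>1 - w / K\<close>, with \<open>w\<close> from \<open>corrector\<close>, is a subsolution for the factor
  \<open>1 - (c + \<epsilon>) / K\<close>, and twice this function is a supersolution for \<open>1 - (c - \<epsilon>) / K\<close>. At order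
  \<open>1 / K\<close> the killing \<open>rate / K\<close> and the drift \<open>(transition w - w) / K\<close> add up to
  \<open>c / K\<close>; all other terms are of order \<open>1 / K\<^sup>2\<close> and disappear in the slack \<open>\<epsilon>\<close> when \<open>K\<close>
  exceeds the constant \<open>X\<close> of the proof.
\<close>
lemma survival_bounds:
  assumes \<epsilon>: "0 < \<epsilon>" "\<epsilon> < c"
  shows "\<exists>K0. \<forall>K\<ge>K0. \<forall>n. \<forall>s\<in>{0..\<theta>}.
    (1 - (c + \<epsilon>) / real K) ^ n / 2 \<le> survival K n s \<and> survival K n s \<le> 2 * (1 - (c - \<epsilon>) / real K) ^ n"
proof -
  obtain w W where W: "0 \<le> W" and w0: "\<And>t. t \<in> {0..\<theta>} \<Longrightarrow> 0 \<le> w t"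
    and wW: "\<And>t. t \<in> {0..\<theta>} \<Longrightarrow> w t \<le> W"
    and corr: "\<And>t. t \<in> {0..\<theta>} \<Longrightarrow> \<bar>rate t + transition w t - w t - c\<bar> \<le> \<epsilon> / 2"
    by (rule corrector[of "\<epsilon> / 2"]) (use \<epsilon> in simp, blast)
  define R where "R = real m + 1"
  define X where "X = R + 2 * W + (c + \<epsilon>) + 2 * (c + \<epsilon>) * W / \<epsilon> + 2 * R * (1 + W) / \<epsilon>"
  have terms: "0 \<le> R" "0 \<le> 2 * W" "0 \<le> c + \<epsilon>" "0 \<le> 2 * (c + \<epsilon>) * W / \<epsilon>" "0 \<le> 2 * R * (1 + W) / \<epsilon>"
    using W \<epsilon> by (auto simp: R_def)
  have "(1 - (c + \<epsilon>) / real K) ^ n / 2 \<le> survival K n s \<and> survival K n s \<le> 2 * (1 - (c - \<epsilon>) / real K) ^ n"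
    if K: "nat \<lceil>X\<rceil> \<le> K" and s: "s \<in> {0..\<theta>}" for K n s
  proof -
    define k where "k = real K"
    have kX: "X \<le> k" using K unfolding k_def by linarith
    have k1: "R \<le> k" "2 * W \<le> k" "c + \<epsilon> \<le> k" and k4: "2 * (c + \<epsilon>) * W / \<epsilon> \<le> k" and k5: "2 * R * (1 + W) / \<epsilon> \<le> k"
      using kX terms unfolding X_def by linarith+
    have k0: "k > 0" and mK: "m \<le> K" "0 < K" using k1(1) unfolding R_def k_def by linarith+
    have k4': "(c + \<epsilon>) * W / k \<le> \<epsilon> / 2" and k5': "R * (1 + W) / k \<le> \<epsilon> / 2"
      using k4 k5 k0 \<epsilon> by (simp_all add: field_simps)
    have sumw: "(\<Sum>i<K - m. weight (m + i) t) = 1 - tail K t" if "t \<in> {0..\<theta>}" for t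
      using weight_partial_sum[of t "K - m"] that mK by simp
    define S where "S t = (\<Sum>i<K - m. weight (m + i) t * w (branch (m + i) t))" for t
    have S_up: "S t \<le> transition w t" if "t \<in> {0..\<theta>}" for t
      unfolding S_def using w0 wW that by (intro transition_partial_le[of w W]) auto
    \<comment> \<open>Only upper bounds for partial sums are at hand, so the lower bound comes from \<open>W - w\<close>.\<close>
    have S_lo: "transition w t - W * tail K t \<le> S t" if t: "t \<in> {0..\<theta>}" for t
    proof -
      have "(\<Sum>i<K - m. weight (m + i) t * (W - w (branch (m + i) t))) \<le> transition (\<lambda>t. W - w t) t"
        using w0 wW t by (intro transition_partial_le[of "\<lambda>t. W - w t" W]) auto
      also have "transition (\<lambda>t. W - w t) t = W - transition w t"
        using transition_add_scaled[of "\<lambda>_. W" W w W t 1 "-1"] w0 wW W t by (simp add: transition_const)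
      also have "(\<Sum>i<K - m. weight (m + i) t * (W - w (branch (m + i) t))) = W * (1 - tail K t) - S t"
        by (simp add: S_def sumw[OF t, symmetric] sum_distrib_left sum_subtractf algebra_simps)
      finally show ?thesis by (simp add: algebra_simps)
    qed
    define f where "f t = 1 - w t / k" for t
    have f_up: "f t \<le> 1" and f_lo: "1 / 2 \<le> f t" if "t \<in> {0..\<theta>}" for t
      using w0[OF that] wW[OF that] k0 k1(2) unfolding f_def by (auto simp: field_simps)
    have Sf: "(\<Sum>i<K - m. weight (m + i) t * f (branch (m + i) t)) = 1 - tail K t - S t / k"
      if "t \<in> {0..\<theta>}" for t
      by (simp add: f_def S_def sumw[OF that, symmetric] sum_divide_distrib sum_subtractf algebra_simps)
    have lo: "(1 - (c + \<epsilon>) / k) ^ n * f s \<le> survival K n s"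
    proof (rule survival_ge_power[OF _ f_up _ s])
      show "0 \<le> 1 - (c + \<epsilon>) / k" using k1(3) k0 by simp
      fix t assume t: "t \<in> {0..\<theta>}"
      have "(c + \<epsilon>) * w t / k \<le> (c + \<epsilon>) * W / k"
        using wW[OF t] k0 terms(3) by (intro divide_right_mono mult_left_mono) auto
      then have "rate t + transition w t \<le> (c + \<epsilon>) + w t - (c + \<epsilon>) * w t / k"
        using corr[OF t] k4' by linarith
      then have "(rate t + transition w t) / k \<le> ((c + \<epsilon>) + w t - (c + \<epsilon>) * w t / k) / k"
        using k0 by (intro divide_right_mono) auto
      moreover have "(1 - (c + \<epsilon>) / k) * f t = 1 - ((c + \<epsilon>) + w t - (c + \<epsilon>) * w t / k) / k"
        using k0 by (simp add: f_def field_simps)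
      moreover have "tail K t \<le> rate t / k" using tail_rate(1)[OF t mK(2)] by (simp add: k_def)
      moreover have "S t / k \<le> transition w t / k" using S_up[OF t] k0 by (simp add: divide_right_mono)
      ultimately show "(1 - (c + \<epsilon>) / k) * f t \<le> (\<Sum>i<K - m. weight (m + i) t * f (branch (m + i) t))"
        unfolding Sf[OF t] by (simp add: add_divide_distrib)
    qed
    have up: "survival K n s \<le> (1 - (c - \<epsilon>) / k) ^ n * (2 * f s)"
    proof (rule survival_le_power[OF _ _ _ s])
      show "0 \<le> 1 - (c - \<epsilon>) / k" using k1(3) k0 \<epsilon> by simp
      show "1 \<le> 2 * f t" if "t \<in> {0..\<theta>}" for t using f_lo[OF that] by simp
      fix t assume t: "t \<in> {0..\<theta>}"
      have r: "0 \<le> rate t" "rate t \<le> R" using rate_bounds[OF t] by (auto simp: R_def)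
      have "rate t * (1 + W) / k \<le> R * (1 + W) / k"
        using r k0 W by (intro divide_right_mono mult_right_mono) auto
      then have "c - \<epsilon> + w t \<le> rate t + transition w t - rate t * (1 + W) / k"
        using corr[OF t] k5' by linarith
      then have "(c - \<epsilon> + w t) / k \<le> (rate t + transition w t - rate t * (1 + W) / k) / k"
        using k0 by (intro divide_right_mono) auto
      also have "\<dots> = rate t / k - rate t / k / k + (transition w t - W * (rate t / k)) / k"
        using k0 by (simp add: field_simps)
      also have "\<dots> \<le> tail K t + S t / k"
      proof (rule add_mono)
        have "rate t / k - rate t / k / k \<le> rate t / (k + 1)"
          using k0 r by (simp add: field_simps)
        then show "rate t / k - rate t / k / k \<le> tail K t"
          using tail_rate(2)[OF t mK(2)] unfolding k_def by linarith
        have "W * tail K t \<le> W * (rate t / k)"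
          using tail_rate(1)[OF t mK(2)] W unfolding k_def by (intro mult_left_mono)
        then show "(transition w t - W * (rate t / k)) / k \<le> S t / k"
          using S_lo[OF t] k0 by (intro divide_right_mono) linarith+
      qed
      finally have "1 - tail K t - S t / k \<le> 1 - (c - \<epsilon> + w t) / k" by linarith
      also have "\<dots> \<le> (1 - (c - \<epsilon>) / k) * f t"
        using k0 \<epsilon> w0[OF t] mult_right_mono[of \<epsilon> c "w t"] by (simp add: f_def field_simps)
      finally have "1 - tail K t - S t / k \<le> (1 - (c - \<epsilon>) / k) * f t" .
      then have "2 * (\<Sum>i<K - m. weight (m + i) t * f (branch (m + i) t)) \<le> (1 - (c - \<epsilon>) / k) * (2 * f t)"
        unfolding Sf[OF t] by (simp add: mult.left_commute)
      then show "(\<Sum>i<K - m. weight (m + i) t * (2 * f (branch (m + i) t))) \<le> (1 - (c - \<epsilon>) / k) * (2 * f t)"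
        by (simp add: sum_distrib_left mult_ac)
    qed
    have "(1 - (c + \<epsilon>) / k) ^ n * (1 / 2) \<le> (1 - (c + \<epsilon>) / k) ^ n * f s"
      using f_lo[OF s] k1(3) k0 by (intro mult_left_mono) auto
    moreover have "(1 - (c - \<epsilon>) / k) ^ n * (2 * f s) \<le> (1 - (c - \<epsilon>) / k) ^ n * (2 * 1)"
      using f_up[OF s] k1(3) k0 \<epsilon> by (intro mult_left_mono) auto
    ultimately show ?thesis using lo up unfolding k_def by (simp add: mult_ac)
  qed
  then show ?thesis by blast
qed

text \<open>
  Each digit is at least \<open>K\<close> with conditional probability at most \<open>(m + 1) / K\<close>.
\<close>
lemma survival_union_bound:
  assumes K: "m \<le> K" "0 < K"
  shows "s \<in> {0..\<theta>} \<Longrightarrow> 1 - real n * (real m + 1) / real K \<le> survival K n s"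
proof (induction n arbitrary: s)
  case (Suc n)
  define b where "b = (real m + 1) / real K"
  have s0: "0 \<le> s" using Suc by simp
  have "tail K s \<le> b"
    using tail_rate(1)[OF Suc.prems K(2)] divide_right_mono[OF rate_bounds(2)[OF Suc.prems], of "real K"]
    by (simp add: b_def)
  moreover have "0 \<le> real n * b * tail K s"
    using tail_nonneg[OF s0 K(1)] by (simp add: b_def)
  ultimately have "1 - real (Suc n) * b \<le> (1 - tail K s) * (1 - real n * b)"
    by (simp add: algebra_simps)
  also have "1 - tail K s = (\<Sum>i<K - m. weight (m + i) s)"
    using weight_partial_sum[OF s0, of "K - m"] K by simp
  also have "\<dots> * (1 - real n * b) = (\<Sum>i<K - m. weight (m + i) s * (1 - real n * b))"
    by (rule sum_distrib_right)
  also have "\<dots> \<le> survival K (Suc n) s"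
    unfolding survival_Suc[OF Suc.prems]
    using Suc.IH[OF branch_mem[OF s0]] weight_nonneg[OF s0] by (intro sum_mono mult_left_mono) (simp_all add: b_def)
  finally show ?case by (simp add: b_def)
qed (simp add: survival_0)

text \<open>
  The bound \<open>(1 - t c / K) ^ N \<le> exp (- t c N / K)\<close> with \<open>K\<close> about \<open>b c N / ln (ln N)\<close> gives
  the power \<open>- t / b\<close> of \<open>ln N\<close>. As \<open>b < 1\<close>, there is room for \<open>1 < q < t / b\<close> with \<open>t < 1\<close>;
  the gap between \<open>q b\<close> and \<open>t\<close> pays for rounding \<open>K\<close>.
\<close>
lemma survival_le_loglog:
  assumes b: "0 < b" "b < 1"
  shows "\<exists>q>1. eventually (\<lambda>N. survival (nat \<lceil>b * c * real N / ln (ln (real N))\<rceil>) N 0 \<le> 2 * ln (real N) powr (- q)) sequentially"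
proof -
  define q where "q = (1 + b) / (2 * b)"
  define t where "t = (1 + q * b) / 2"
  have qb: "q * b = (1 + b) / 2" using b by (simp add: q_def field_simps)
  have q1: "q > 1" using b by (simp add: q_def)
  have t: "t < 1" "q * b < t" "0 < t" unfolding t_def qb using b by (simp_all add: add_pos_pos)
  have "0 < c * (1 - t)" "c * (1 - t) < c" using c_pos t by auto
  from survival_bounds[OF this] obtain K0 where K0: "\<And>K n s. K0 \<le> K \<Longrightarrow> s \<in> {0..\<theta>} \<Longrightarrow>
      survival K n s \<le> 2 * (1 - (c - c * (1 - t)) / real K) ^ n" by blast
  have bc: "b * c > 0" using b c_pos by simp
  have ev1: "eventually (\<lambda>N. real K0 + c + 1 \<le> b * c * real N / ln (ln (real N))) sequentially"
    using bc by real_asymp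
  have d: "(t - q * b) * c > 0" using t c_pos by simp
  have ev2: "eventually (\<lambda>N. q * ln (ln (real N)) \<le> (t - q * b) * c * real N) sequentially"
    using d q1 by real_asymp
  have ev3: "eventually (\<lambda>N. ln (ln (real N)) > 0) sequentially" by real_asymp
  have ev4: "eventually (\<lambda>N. ln (real N) > 0) sequentially" by real_asymp
  have "eventually (\<lambda>N. survival (nat \<lceil>b * c * real N / ln (ln (real N))\<rceil>) N 0 \<le> 2 * ln (real N) powr (- q)) sequentially"
    using ev1 ev2 ev3 ev4
  proof eventually_elim
    case (elim N)
    define l where "l = ln (ln (real N))"
    define K where "K = nat \<lceil>b * c * real N / l\<rceil>"
    have l: "l > 0" using elim by (simp add: l_def)
    have K_lo: "b * c * real N / l \<le> real K" and K_up: "real K \<le> b * c * real N / l + 1"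
      using elim(1) c_pos unfolding K_def l_def[symmetric] by linarith+
    have K: "K0 \<le> K" "c \<le> real K" "0 < real K" using elim(1) K_lo c_pos unfolding l_def[symmetric] by linarith+
    have "q * l * real K \<le> q * l * (b * c * real N / l + 1)"
      using K_up q1 l by (intro mult_left_mono) auto
    also have "\<dots> = q * b * c * real N + q * l" using l by (simp add: field_simps)
    also have "\<dots> \<le> t * c * real N" using elim(2) by (simp add: l_def algebra_simps)
    finally have ql: "q * l \<le> real N * (t * c / real K)" using K by (simp add: field_simps)
    have "t * c \<le> 1 * c" using t c_pos by (intro mult_right_mono) auto
    then have tc: "t * c / real K \<le> 1" using K by simp
    have "survival K N 0 \<le> 2 * (1 - t * c / real K) ^ N"
      using K0[OF K(1), of 0 N] theta_pos by (simp add: algebra_simps)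
    also have "(1 - t * c / real K) ^ N \<le> exp (- (t * c / real K)) ^ N"
      using tc exp_ge_add_one_self[of "- (t * c / real K)"] by (intro power_mono) auto
    also have "\<dots> = exp (- (real N * (t * c / real K)))" by (simp add: exp_of_nat_mult[symmetric])
    also have "\<dots> \<le> exp (- (q * l))" using ql by simp
    also have "\<dots> = ln (real N) powr (- q)" using elim by (simp add: powr_def l_def)
    finally show ?case by (simp add: K_def l_def)
  qed
  with q1 show ?thesis by blast
qed

text \<open>
  The mirror image for \<open>b > 1\<close>, now with \<open>1 < t < q b\<close> and \<open>q < 1\<close>. The power
  \<open>(1 - x) ^ N\<close> is bounded from below through \<open>1 - x \<ge> exp (- x / (1 - x))\<close>, and the
  denominator \<open>1 - x\<close> is absorbed by the gap as well.
\<close>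
lemma survival_ge_loglog:
  assumes b: "1 < b" "b < 2"
  shows "\<exists>q. 0 < q \<and> q < 1 \<and> eventually (\<lambda>N. \<forall>s\<in>{0..\<theta>}.
    ln (real N) powr (- q) / 2 \<le> survival (nat \<lfloor>b * c * real N / ln (ln (real N))\<rfloor>) N s) sequentially"
proof -
  define q where "q = (1 + b) / (2 * b)"
  define t where "t = (1 + q * b) / 2"
  have qb: "q * b = (1 + b) / 2" using b by (simp add: q_def field_simps)
  have q1: "0 < q" "q < 1" using b by (simp_all add: q_def)
  have t: "1 < t" "t < q * b" "t < 2" unfolding t_def qb using b by (simp_all add: add_pos_pos)
  have "0 < c * (t - 1)" "c * (t - 1) < c" using c_pos t by auto
  from survival_bounds[OF this] obtain K0 where K0: "\<And>K n s. K0 \<le> K \<Longrightarrow> s \<in> {0..\<theta>} \<Longrightarrow>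
      (1 - (c + c * (t - 1)) / real K) ^ n / 2 \<le> survival K n s" by blast
  have bc: "b * c > 0" using b c_pos by simp
  have ev1: "eventually (\<lambda>N. real K0 + t * c + 2 \<le> b * c * real N / ln (ln (real N))) sequentially"
    using bc by real_asymp
  have d: "(q * b - t) * c > 0" using t c_pos by simp
  have d': "q * (1 + t * c) > 0" using t c_pos q1 by (simp add: add_pos_pos)
  have ev2: "eventually (\<lambda>N. q * (1 + t * c) * ln (ln (real N)) \<le> (q * b - t) * c * real N) sequentially"
    using d d' by real_asymp
  have ev3: "eventually (\<lambda>N. ln (ln (real N)) > 0) sequentially" by real_asymp
  have ev4: "eventually (\<lambda>N. ln (real N) > 0) sequentially" by real_asymp
  have "eventually (\<lambda>N. \<forall>s\<in>{0..\<theta>}.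
    ln (real N) powr (- q) / 2 \<le> survival (nat \<lfloor>b * c * real N / ln (ln (real N))\<rfloor>) N s) sequentially"
    using ev1 ev2 ev3 ev4
  proof eventually_elim
    case (elim N)
    define l where "l = ln (ln (real N))"
    define K where "K = nat \<lfloor>b * c * real N / l\<rfloor>"
    define x where "x = t * c / real K"
    have tc: "t * c > 0" using t c_pos by simp
    have l: "l > 0" using elim by (simp add: l_def)
    have K_lo: "b * c * real N / l - 1 \<le> real K"
      using elim(1) tc unfolding K_def l_def[symmetric] by linarith
    have K: "K0 \<le> K" "t * c < real K" "0 < real K" using elim(1) K_lo tc unfolding l_def[symmetric] by linarith+
    have x: "0 < x" "x < 1" using K tc by (auto simp: x_def)
    have "real N * (t * c) \<le> q * b * c * real N - q * (1 + t * c) * l"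
      using elim(2) by (simp add: l_def algebra_simps)
    also have "\<dots> = q * l * (b * c * real N / l - 1 - t * c)" using l by (simp add: field_simps)
    also have "\<dots> \<le> q * l * (real K - t * c)"
      using K_lo q1 l by (intro mult_left_mono) auto
    finally have "real N * (t * c) / (real K - t * c) \<le> q * l"
      using K by (simp add: pos_divide_le_eq)
    moreover have "x / (1 - x) = t * c / (real K - t * c)" using K by (simp add: x_def field_simps)
    ultimately have ql: "real N * (x / (1 - x)) \<le> q * l" by simp
    have "1 / (1 - x) = 1 + x / (1 - x)" using x by (simp add: field_simps)
    also have "\<dots> \<le> exp (x / (1 - x))" by (rule exp_ge_add_one_self)
    finally have ex: "exp (- (x / (1 - x))) \<le> 1 - x" using x by (simp add: exp_minus field_simps)
    have "ln (real N) powr (- q) = exp (- (q * l))" using elim by (simp add: powr_def l_def)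
    also have "\<dots> \<le> exp (- (real N * (x / (1 - x))))" using ql by simp
    also have "\<dots> = exp (- (x / (1 - x))) ^ N" by (simp add: exp_of_nat_mult[symmetric])
    also have "\<dots> \<le> (1 - x) ^ N" using ex by (intro power_mono) auto
    finally have "ln (real N) powr (- q) / 2 \<le> (1 - x) ^ N / 2" by simp
    then show ?case
      using K0[OF K(1), of _ N] unfolding K_def[symmetric] l_def[symmetric] x_def
      by (force simp: algebra_simps)
  qed
  with q1 show ?thesis by blast
qed

section \<open>The lower bound for the limes inferior\<close>

definition ratio :: "real \<Rightarrow> nat \<Rightarrow> ereal" where
  "ratio x N = ereal_of_enat (max_digit \<theta> N x) * ereal (ln (ln (real N))) / ereal (real N)"

lemma max_digit_less_iff:
  "N \<ge> 1 \<Longrightarrow> max_digit \<theta> N x < k \<longleftrightarrow> (\<forall>d\<in>set (digits N x). d < k)"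
  unfolding max_digit_def set_digits by (subst Max_less_iff) auto

lemma max_digit_mono: "1 \<le> N \<Longrightarrow> N \<le> N' \<Longrightarrow> max_digit \<theta> N x \<le> max_digit \<theta> N' x"
  unfolding max_digit_def by (intro Max_mono image_mono) auto

lemma le_ratio:
  assumes "enat k \<le> max_digit \<theta> N x" "0 \<le> ln (ln (real N))" "0 < N" "v \<le> real k * ln (ln (real N)) / real N"
  shows "ereal v \<le> ratio x N"
proof -
  have "ereal (real k) \<le> ereal_of_enat (max_digit \<theta> N x)"
    using assms(1) by (metis ereal_of_enat_le_iff ereal_of_enat_simps(1))
  then have "ereal (real k) * ereal (ln (ln (real N))) / ereal (real N) \<le> ratio x N"
    unfolding ratio_def using assms(2,3)
    by (intro ereal_divide_right_mono ereal_mult_right_mono) simp_all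
  moreover have "ereal (real k) * ereal (ln (ln (real N))) / ereal (real N) = ereal (real k * ln (ln (real N)) / real N)"
    using assms(3) by simp
  ultimately show ?thesis using assms(4) by (metis ereal_less_eq(3) order_trans)
qed

lemma ratio_le:
  assumes "max_digit \<theta> N x \<le> enat k" "0 \<le> ln (ln (real N))" "0 < N" "real k * ln (ln (real N)) / real N \<le> v"
  shows "ratio x N \<le> ereal v"
proof -
  have "ereal_of_enat (max_digit \<theta> N x) \<le> ereal (real k)"
    using assms(1) by (metis ereal_of_enat_le_iff ereal_of_enat_simps(1))
  then have "ratio x N \<le> ereal (real k) * ereal (ln (ln (real N))) / ereal (real N)"
    unfolding ratio_def using assms(2,3)
    by (intro ereal_divide_right_mono ereal_mult_right_mono) simp_all
  also have "\<dots> = ereal (real k * ln (ln (real N)) / real N)" using assms(3) by simp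
  finally show ?thesis using assms(4) by (metis ereal_less_eq(3) order_trans)
qed

lemma zero_mem: "0 \<in> {0..\<theta>}"
  using theta_pos by simp

lemma measure_large_digit:
  assumes "s \<in> {0..\<theta>}"
  shows "measure (law s) {x. \<exists>d\<in>set (digits n x). \<not> d < enat k} = 1 - survival k n s"
proof -
  interpret prob_space "law s" using assms by (rule prob_space_law)
  have "{x. \<exists>d\<in>set (digits n x). \<not> d < enat k} = space (law s) - {x. \<forall>d\<in>set (digits n x). d < enat k}"
    by auto
  then show ?thesis
    unfolding survival_def using digits_sets[of "\<lambda>l. \<forall>d\<in>set l. d < enat k" n]
    by (simp only: prob_compl sets_law)
qed

text \<open>
  Survival up to the times \<open>\<nu> j\<close>, about \<open>exp (h j)\<close>, is summable by \<open>survival_le_loglog\<close>.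
  Between consecutive times the maximal digit can only grow, while the normalisation changes by at
  most a factor close to \<open>exp h\<close>; the step \<open>h\<close> is chosen so small that \<open>b / exp h > a\<close>.
\<close>
lemma AE_eventually_ratio_ge:
  assumes a: "0 < a" "a < 1"
  shows "AE x in law 0. eventually (\<lambda>N. ereal (a * c) \<le> ratio x N) sequentially"
proof -
  interpret prob_space "law 0" by (rule prob_space_law[OF zero_mem])
  define b where "b = (1 + a) / 2"
  have b: "0 < b" "b < 1" "a < b" using a by (auto simp: b_def)
  \<comment> \<open>Any step with \<open>1 < exp h < b / a\<close> would do; this one makes \<open>exp h\<close> the midpoint of \<open>1\<close> and \<open>b / a\<close>.\<close>
  define h where "h = ln ((b + a) / (2 * a))"
  have "1 < (b + a) / (2 * a)" using a b by simp
  then have h: "h > 0" and eh: "exp h = (b + a) / (2 * a)" using a b by (simp_all add: h_def)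
  have "2 * a < b + a" using b by simp
  then have "a * (b + a) / (2 * a) < b" using a b by (simp add: field_simps)
  then have gap: "b / exp h - a > 0" using a b unfolding eh by (simp add: field_simps)
  obtain q where q: "q > 1" and ev: "eventually (\<lambda>N. survival (nat \<lceil>b * c * real N / ln (ln (real N))\<rceil>) N 0 \<le> 2 * ln (real N) powr (- q)) sequentially"
    using survival_le_loglog[OF b(1,2)] by blast
  define k where "k N = nat \<lceil>b * c * real N / ln (ln (real N))\<rceil>" for N :: nat
  define \<nu> where "\<nu> j = nat \<lfloor>exp (h * real j)\<rfloor>" for j :: nat
  define A where "A j = {x. \<forall>d\<in>set (digits (\<nu> j) x). d < enat (k (\<nu> j))}" for j
  have \<nu>_lim: "filterlim \<nu> at_top sequentially"
    unfolding \<nu>_def using h by real_asymp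
  have \<nu>_lo: "exp (h * real j) - 1 \<le> real (\<nu> j)" for j unfolding \<nu>_def by linarith
  have \<nu>_up: "real (\<nu> j) \<le> exp (h * real j)" for j unfolding \<nu>_def by simp
  have sum: "summable (\<lambda>j. measure (law 0) (A j))"
  proof (rule summable_comparison_test_ev)
    have "summable (\<lambda>j. 2 * (h / 2) powr (- q) * real j powr (- q))"
      using q by (intro summable_mult) (simp add: summable_real_powr_iff)
    then show "summable (\<lambda>j. 2 * (h / 2) powr (- q) * real j powr (- q))" .
    have e1: "eventually (\<lambda>j. survival (k (\<nu> j)) (\<nu> j) 0 \<le> 2 * ln (real (\<nu> j)) powr (- q)) sequentially"
      using ev \<nu>_lim unfolding k_def by (rule eventually_compose_filterlim)
    have e2: "eventually (\<lambda>j. h / 2 * real j \<le> ln (exp (h * real j) - 1)) sequentially"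
      using h by real_asymp
    have e3: "eventually (\<lambda>j. exp (h * real j) - 1 > 0) sequentially" using h by real_asymp
    show "eventually (\<lambda>j. norm (measure (law 0) (A j)) \<le> 2 * (h / 2) powr (- q) * real j powr (- q)) sequentially"
      using e1 e2 e3 eventually_gt_at_top[of 0]
    proof eventually_elim
      case (elim j)
      have "ln (exp (h * real j) - 1) \<le> ln (real (\<nu> j))"
        using elim(3) \<nu>_lo[of j] by (intro ln_mono)
      then have "ln (real (\<nu> j)) powr (- q) \<le> (h / 2 * real j) powr (- q)"
        using elim h q by (intro powr_mono2') auto
      also have "\<dots> = (h / 2) powr (- q) * real j powr (- q)" by (rule powr_mult)
      finally show ?case using elim(1) by (simp add: A_def survival_def)
    qed
  qed
  have "AE x in law 0. eventually (\<lambda>j. x \<in> space (law 0) - A j) sequentially"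
  proof (rule borel_cantelli_AE1[OF _ _ sum])
    show "A j \<in> sets (law 0)" for j
      unfolding A_def sets_law by (rule digits_sets[of "\<lambda>l. \<forall>d\<in>set l. d < enat (k (\<nu> j))"])
  qed (simp add: emeasure_eq_measure)
  then show ?thesis
  proof eventually_elim
    case (elim x)
    define J where "J N = nat \<lfloor>ln (real N) / h\<rfloor>" for N :: nat
    have J_lim: "filterlim J at_top sequentially" unfolding J_def using h by real_asymp
    have e1: "eventually (\<lambda>N. x \<notin> A (J N)) sequentially"
      using eventually_compose_filterlim[OF elim J_lim] by (simp add: eventually_mono)
    have e2: "eventually (\<lambda>N. 1 < ln (real N / exp h - 1)) sequentially"
      using h by real_asymp
    have e3: "eventually (\<lambda>N. 1 \<le> real N / exp h - 1) sequentially"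
      using h by real_asymp
    have e4: "eventually (\<lambda>N. b / real N < (b / exp h - a)) sequentially"
      using gap b by real_asymp
    show "eventually (\<lambda>N. ereal (a * c) \<le> ratio x N) sequentially"
      using e1 e2 e3 e4 eventually_gt_at_top[of 0]
    proof eventually_elim
      case (elim N)
      have N: "real N \<ge> 1" using elim by simp
      have lnN: "0 \<le> ln (real N) / h" using N h by simp
      have "real (J N) \<le> ln (real N) / h" "ln (real N) / h < real (J N) + 1"
        using lnN unfolding J_def by linarith+
      then have "h * real (J N) \<le> ln (real N)" "ln (real N) \<le> h * real (J N) + h"
        using h by (simp_all add: field_simps)
      then have "exp (h * real (J N)) \<le> exp (ln (real N))" "exp (ln (real N)) \<le> exp (h * real (J N) + h)"
        by (simp_all only: exp_le_cancel_iff)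
      then have up: "exp (h * real (J N)) \<le> real N" and "real N \<le> exp (h * real (J N)) * exp h"
        using N by (simp_all add: exp_add)
      then have lo: "real N / exp h \<le> exp (h * real (J N))" by (simp add: divide_simps)
      define v where "v = \<nu> (J N)"
      have v_up: "v \<le> N" using \<nu>_up[of "J N"] up by (simp add: v_def)
      have v_lo: "real N / exp h - 1 \<le> real v" using \<nu>_lo[of "J N"] lo by (simp add: v_def)
      have v1: "1 \<le> v" using v_lo elim(3) by simp
      have lnv: "1 < ln (real v)"
        using elim(2,3) v_lo ln_le_cancel_iff[of "real N / exp h - 1" "real v"] by linarith
      have "ln (real v) \<le> ln (real N)" using v1 v_up by simp
      then have lln: "0 < ln (ln (real v))" "ln (ln (real v)) \<le> ln (ln (real N))" using lnv by simp_all
      have "\<not> max_digit \<theta> v x < enat (k v)"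
        using elim(1) max_digit_less_iff[OF v1] by (simp add: A_def v_def)
      then have max: "enat (k v) \<le> max_digit \<theta> N x"
        using max_digit_mono[OF v1 v_up, of x] by simp
      have "b * c * (real N / exp h - 1) / ln (ln (real N)) \<le> b * c * real v / ln (ln (real v))"
        using v_lo lln b c_pos elim(3) by (intro frac_le mult_left_mono) auto
      also have "\<dots> \<le> real (k v)" unfolding k_def by linarith
      finally have kv: "b * c * (real N / exp h - 1) \<le> real (k v) * ln (ln (real N))"
        using lln by (simp add: pos_divide_le_eq)
      have "a * c \<le> (b / exp h - b / real N) * c"
        using elim(4) c_pos by (intro mult_right_mono) auto
      also have "\<dots> = b * c * (real N / exp h - 1) / real N" using N by (simp add: field_simps)
      also have "\<dots> \<le> real (k v) * ln (ln (real N)) / real N" using kv by (intro divide_right_mono) auto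
      finally show ?case using max lln N by (intro le_ratio[of "k v"]) auto
    qed
  qed
qed

section \<open>The upper bound for the limes inferior\<close>

text \<open>
  The points for which each of the \<open>r\<close> blocks number \<open>i, \<dots>, i + r - 1\<close> contains a large digit,
  where block \<open>j\<close> has \<open>n j\<close> digits and threshold \<open>k j\<close>, and block \<open>i\<close> begins with the first
  digit of the point. The recursion from the front matches \<open>past_future\<close>.
\<close>
fun barren :: "(nat \<Rightarrow> nat) \<Rightarrow> (nat \<Rightarrow> nat) \<Rightarrow> nat \<Rightarrow> nat \<Rightarrow> real set" where
  "barren n k i 0 = UNIV"
| "barren n k i (Suc r) = {y. (\<exists>d\<in>set (digits (n i) y). \<not> d < enat (k i)) \<and> (theta_map \<theta> ^^ n i) y \<in> barren n k (Suc i) r}"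

lemma barren_sets: "barren n k i r \<in> sets borel"
proof (induction r arbitrary: i)
  case (Suc r)
  have "barren n k i (Suc r) = {y. \<exists>d\<in>set (digits (n i) y). \<not> d < enat (k i)} \<inter>
    ((theta_map \<theta> ^^ n i) -` barren n k (Suc i) r \<inter> space borel)" by auto
  also have "\<dots> \<in> sets borel"
    by (rule sets.Int[OF digits_sets[of "\<lambda>l. \<exists>d\<in>set l. \<not> d < enat (k i)"] measurable_sets[OF theta_map_iter_measurable Suc]])
  finally show ?case .
qed simp

text \<open>
  By \<open>past_future\<close> the bounds for the conditional failure probabilities, \<open>1 - 1 / (j + 1) = j / (j + 1)\<close>, multiply,
  and their product telescopes.
\<close>
lemma barren_prob:
  assumes p: "\<And>i s. i0 \<le> i \<Longrightarrow> s \<in> {0..\<theta>} \<Longrightarrow> 1 / (real i + 1) \<le> survival (k i) (n i) s"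
  shows "i0 \<le> i \<Longrightarrow> 0 < i \<Longrightarrow> s \<in> {0..\<theta>} \<Longrightarrow>
    emeasure (law s) (barren n k i r) \<le> ennreal (real i / (real i + real r))"
proof (induction r arbitrary: i s)
  case 0
  interpret prob_space "law s" using 0 by (intro prob_space_law)
  show ?case using 0 emeasure_space_1 by simp
next
  case (Suc r)
  interpret prob_space "law s" using Suc.prems by (intro prob_space_law)
  have "emeasure (law s) (barren n k i (Suc r))
    \<le> ennreal (real (Suc i) / (real (Suc i) + real r)) * emeasure (law s) {y. \<exists>d\<in>set (digits (n i) y). \<not> d < enat (k i)}"
    unfolding barren.simps
    using Suc.IH[of "Suc i"] Suc.prems
    by (intro past_future[OF barren_sets, where s = s and P = "\<lambda>l. \<exists>d\<in>set l. \<not> d < enat (k i)"]) auto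
  also have "\<dots> \<le> ennreal (real (Suc i) / (real (Suc i) + real r)) * ennreal (1 - 1 / (real i + 1))"
    unfolding emeasure_eq_measure measure_large_digit[OF Suc.prems(3)]
    using p[OF Suc.prems(1,3)] by (intro mult_left_mono ennreal_leI) auto
  also have "\<dots> = ennreal (real (Suc i) / (real (Suc i) + real r) * (1 - 1 / (real i + 1)))"
    by (rule ennreal_mult[symmetric]) auto
  also have "1 - 1 / (real i + 1) = real i / real (Suc i)" by (simp add: field_simps)
  also have "real (Suc i) / (real (Suc i) + real r) * (real i / real (Suc i)) = real i / (real i + real (Suc r))"
    by (simp add: add_ac)
  finally show ?case .
qed

lemma barrenI:
  assumes "\<And>j. i \<le> j \<Longrightarrow> \<exists>d\<in>set (digits (n j) ((theta_map \<theta> ^^ (\<Sum>l<j. n l)) x)). \<not> d < enat (k j)"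
  shows "(theta_map \<theta> ^^ (\<Sum>l<i. n l)) x \<in> barren n k i r"
  using assms
proof (induction r arbitrary: i)
  case (Suc r)
  have "(theta_map \<theta> ^^ n i) ((theta_map \<theta> ^^ (\<Sum>l<i. n l)) x) = (theta_map \<theta> ^^ (\<Sum>l<Suc i. n l)) x"
    by (simp add: funpow_add add.commute)
  then show ?case using Suc.IH[of "Suc i"] Suc.prems by simp
qed simp

text \<open>
  A converse Borel--Cantelli lemma for dependent blocks. For large \<open>i\<close> the probability that all blocks
  from number \<open>i\<close> on contain a large digit is at most \<open>i / (i + r)\<close> for all \<open>r\<close>, hence \<open>0\<close>.
\<close>
lemma AE_frequently_small_block:
  assumes p: "eventually (\<lambda>i. \<forall>s\<in>{0..\<theta>}. 1 / (real i + 1) \<le> survival (k i) (n i) s) sequentially"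
  shows "AE x in law 0. frequently (\<lambda>j. \<forall>d\<in>set (digits (n j) ((theta_map \<theta> ^^ (\<Sum>l<j. n l)) x)). d < enat (k j)) sequentially"
proof -
  interpret prob_space "law 0" by (rule prob_space_law[OF zero_mem])
  obtain i0 where i0: "\<And>i s. i0 \<le> i \<Longrightarrow> s \<in> {0..\<theta>} \<Longrightarrow> 1 / (real i + 1) \<le> survival (k i) (n i) s"
    using p unfolding eventually_sequentially by blast
  have "AE x in law 0. \<not> (\<forall>r. (theta_map \<theta> ^^ (\<Sum>l<i. n l)) x \<in> barren n k i r)" if i: "i0 \<le> i" "0 < i" for i
  proof -
    let ?t = "\<Sum>l<i. n l"
    define B where "B r = {x. (theta_map \<theta> ^^ ?t) x \<in> barren n k i r}" for r
    have B: "B r \<in> sets borel" for r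
      using measurable_sets[OF theta_map_iter_measurable[of ?t] barren_sets[of n k i r]]
      by (simp add: B_def vimage_def)
    have "emeasure (law 0) (B r) \<le> ennreal (real i / (real i + real r)) * emeasure (law 0) UNIV" for r
      using past_future[OF barren_sets barren_prob[OF i0 i], where P = "\<lambda>_. True" and s = 0] zero_mem
      by (simp add: B_def)
    then have "emeasure (law 0) (\<Inter>r. B r) \<le> ennreal (real i / (real i + real r))" for r
      using emeasure_mono[of "\<Inter>r. B r" "B r" "law 0"] B emeasure_space_1
      by (auto intro: order_trans)
    moreover have "(\<lambda>r. ennreal (real i / (real i + real r))) \<longlonglongrightarrow> ennreal 0"
      by (intro tendsto_ennrealI) real_asymp
    ultimately have "emeasure (law 0) (\<Inter>r. B r) \<le> ennreal 0"
      by (intro LIMSEQ_le_const[of "\<lambda>r. ennreal (real i / (real i + real r))"]) auto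
    then have "(\<Inter>r. B r) \<in> null_sets (law 0)" using B by (intro null_setsI) auto
    then show ?thesis by (rule AE_I') (auto simp: B_def)
  qed
  then have "AE x in law 0. \<forall>i. i0 \<le> i \<longrightarrow> 0 < i \<longrightarrow> \<not> (\<forall>r. (theta_map \<theta> ^^ (\<Sum>l<i. n l)) x \<in> barren n k i r)"
    by (subst AE_all_countable) auto
  then show ?thesis
  proof eventually_elim
    case (elim x)
    show ?case unfolding frequently_sequentially
    proof
      fix N
      let ?i = "Suc (N + i0)"
      have "\<exists>j\<ge>?i. \<forall>d\<in>set (digits (n j) ((theta_map \<theta> ^^ (\<Sum>l<j. n l)) x)). d < enat (k j)"
        using barrenI[of ?i n x k] elim by (metis le_add2 le_SucI zero_less_Suc)
      then show "\<exists>j\<ge>N. \<forall>d\<in>set (digits (n j) ((theta_map \<theta> ^^ (\<Sum>l<j. n l)) x)). d < enat (k j)"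
        by (meson Suc_leD add_leD1)
    qed
  qed
qed

text \<open>
  With blocks of these lengths, all digits before a block make up a fraction
  of at most \<open>1 / (j + 1)\<^sup>2\<close> of its length.
\<close>
lemma sum_rapid_le: "(j + 1)\<^sup>2 * (\<Sum>l<j. (l + 1) ^ (3 * (l + 1))) \<le> ((j + 1) ^ (3 * (j + 1)) :: nat)"
proof (cases "j = 0")
  case False
  have "(\<Sum>l<j. (l + 1) ^ (3 * (l + 1))) \<le> (\<Sum>l<j. (j + 1) ^ (3 * j))"
  proof (rule sum_mono)
    fix l assume "l \<in> {..<j}"
    then have "(l + 1) ^ (3 * (l + 1)) \<le> (j + 1) ^ (3 * (l + 1))"
      by (intro power_mono) simp_all
    moreover have "(j + 1) ^ (3 * (l + 1)) \<le> (j + 1) ^ (3 * j)"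
      using \<open>l \<in> {..<j}\<close> by (intro power_increasing) simp_all
    ultimately show "(l + 1) ^ (3 * (l + 1)) \<le> (j + 1) ^ (3 * j)" by (rule order_trans)
  qed
  also have "\<dots> \<le> (j + 1) * (j + 1) ^ (3 * j)" by simp
  finally have "(j + 1)\<^sup>2 * (\<Sum>l<j. (l + 1) ^ (3 * (l + 1))) \<le> (j + 1)\<^sup>2 * ((j + 1) * (j + 1) ^ (3 * j))"
    by (rule mult_left_mono) simp
  also have "\<dots> = (j + 1) ^ (2 + (1 + 3 * j))" by (simp only: power_add power_one_right)
  also have "2 + (1 + 3 * j) = 3 * (j + 1)" by simp
  finally show ?thesis .
qed simp

text \<open>
  The lengths \<open>n j = (j + 1) ^ (3 (j + 1))\<close> balance two demands. They grow slowly enough that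
  \<open>ln (n j) = 3 (j + 1) ln (j + 1)\<close> and thus \<open>survival_ge_loglog\<close> provides the probability
  \<open>1 / (j + 1)\<close> needed for infinitely many blocks of small digits. They grow fast enough that the
  union bound for the \<open>t j\<close> digits before the block is of order
  \<open>ln (ln (n j)) / (j + 1)\<^sup>2\<close>, which is summable.
\<close>
lemma AE_frequently_ratio_le:
  assumes b: "1 < b" "b < 2"
  shows "AE x in law 0. frequently (\<lambda>N. ratio x N \<le> ereal (b\<^sup>2 * c)) sequentially"
proof -
  interpret prob_space "law 0" by (rule prob_space_law[OF zero_mem])
  obtain q where q: "0 < q" "q < 1" and ev: "eventually (\<lambda>N. \<forall>s\<in>{0..\<theta>}.
      ln (real N) powr (- q) / 2 \<le> survival (nat \<lfloor>b * c * real N / ln (ln (real N))\<rfloor>) N s) sequentially"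
    using survival_ge_loglog[OF b] by blast
  define \<kappa> where "\<kappa> N = nat \<lfloor>b * c * real N / ln (ln (real N))\<rfloor>" for N :: nat
  define n where "n j = (j + 1) ^ (3 * (j + 1))" for j :: nat
  define t where "t j = (\<Sum>l<j. n l)" for j
  have n_lim: "filterlim n at_top sequentially"
  proof (rule filterlim_at_top_mono[OF filterlim_ident], rule always_eventually, rule allI)
    fix j
    have "j + 1 \<le> (j + 1) ^ (3 * (j + 1))" using power_increasing[of 1 "3 * (j + 1)" "j + 1"] by simp
    then show "j \<le> n j" by (simp add: n_def)
  qed
  have t_le: "real (t j) \<le> real (n j) / (real j + 1)\<^sup>2" for j
  proof -
    have "real ((j + 1)\<^sup>2 * t j) \<le> real (n j)"
      using sum_rapid_le[of j] unfolding t_def n_def by (simp only: of_nat_le_iff)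
    then show ?thesis by (simp add: field_simps)
  qed
  have ln_n: "ln (real (n j)) = 3 * (real j + 1) * ln (real j + 1)" for j
    by (simp add: n_def ln_realpow add.commute)
  have bc: "b * c > 0" "(b - 1) * c > 0" using b c_pos by auto
  have small_block: "AE x in law 0. frequently (\<lambda>j. \<forall>d\<in>set (digits (n j) ((theta_map \<theta> ^^ t j) x)). d < enat (\<kappa> (n j))) sequentially"
    unfolding t_def
  proof (rule AE_frequently_small_block)
    have e1: "eventually (\<lambda>j. 1 / (real j + 1) \<le> (3 * (real j + 1) * ln (real j + 1)) powr (- q) / 2) sequentially"
      using q by real_asymp
    have e2: "eventually (\<lambda>j. \<forall>s\<in>{0..\<theta>}. ln (real (n j)) powr (- q) / 2 \<le> survival (\<kappa> (n j)) (n j) s) sequentially"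
      using eventually_compose_filterlim[OF ev n_lim] by (simp add: \<kappa>_def)
    show "eventually (\<lambda>i. \<forall>s\<in>{0..\<theta>}. 1 / (real i + 1) \<le> survival (\<kappa> (n i)) (n i) s) sequentially"
      using e1 e2 by eventually_elim (auto simp: ln_n intro: order_trans)
  qed
  define A where "A j = {x. \<exists>d\<in>set (digits (t j) x). \<not> d < enat (\<kappa> (n j))}" for j
  have sum: "summable (\<lambda>j. measure (law 0) (A j))"
  proof (rule summable_comparison_test_ev)
    let ?g = "\<lambda>j. (real m + 1) / c * real j powr (- (3 / 2))"
    have "summable ?g" by (intro summable_mult) (simp add: summable_real_powr_iff)
    then show "summable (\<lambda>j. ?g (Suc j))" by (subst summable_Suc_iff)
    have e1: "eventually (\<lambda>N. 1 \<le> (b - 1) * c * real N / ln (ln (real N))) sequentially"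
      using bc by real_asymp
    have e2: "eventually (\<lambda>N. real m + 1 \<le> b * c * real N / ln (ln (real N))) sequentially"
      using bc by real_asymp
    have e3: "eventually (\<lambda>N. 0 < ln (ln (real N))) sequentially" by real_asymp
    have e4: "eventually (\<lambda>j. ln (3 * (real j + 1) * ln (real j + 1)) \<le> (real j + 1) powr (1 / 2)) sequentially"
      by real_asymp
    show "eventually (\<lambda>j. norm (measure (law 0) (A j)) \<le> ?g (Suc j)) sequentially"
      using eventually_compose_filterlim[OF e1 n_lim] eventually_compose_filterlim[OF e2 n_lim]
        eventually_compose_filterlim[OF e3 n_lim] e4
    proof eventually_elim
      case (elim j)
      define l where "l = ln (ln (real (n j)))"
      define K where "K = \<kappa> (n j)"
      have l: "0 < l" using elim by (simp add: l_def)
      have K_lo: "b * c * real (n j) / l - 1 \<le> real K" unfolding K_def \<kappa>_def l_def by linarith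
      have K_m: "real m \<le> real K" using K_lo elim(2) unfolding l_def by linarith
      have nl: "real (n j) > 0" by (simp add: n_def)
      have "c * real (n j) / l = b * c * real (n j) / l - (b - 1) * c * real (n j) / l"
        by (simp add: diff_divide_distrib[symmetric] algebra_simps)
      also have "\<dots> \<le> real K" using K_lo elim(1) unfolding l_def[symmetric] by linarith
      finally have K: "c * real (n j) / l \<le> real K" .
      have cn: "0 < c * real (n j) / l" using c_pos nl l by simp
      have "measure (law 0) (A j) = 1 - survival K (t j) 0"
        unfolding A_def K_def by (rule measure_large_digit[OF zero_mem])
      also have "\<dots> \<le> real (t j) * (real m + 1) / real K"
        using survival_union_bound[OF _ _ zero_mem, of K "t j"] K_m K cn by simp
      also have "\<dots> \<le> (real (n j) / (real j + 1)\<^sup>2) * (real m + 1) / (c * real (n j) / l)"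
        using t_le[of j] K cn by (intro frac_le mult_right_mono) auto
      also have "\<dots> = (real m + 1) / c * (l / (real j + 1)\<^sup>2)" using nl l c_pos by (simp add: field_simps)
      also have "\<dots> \<le> (real m + 1) / c * ((real j + 1) powr (1 / 2) / (real j + 1)\<^sup>2)"
        using elim(4) c_pos by (intro mult_left_mono divide_right_mono) (auto simp: l_def ln_n)
      also have "(real j + 1) powr (1 / 2) / (real j + 1)\<^sup>2 = real (Suc j) powr (- (3 / 2))"
        by (simp add: powr_realpow[symmetric] powr_diff[symmetric] add.commute del: powr_numeral powr_half_sqrt)
      finally show ?case by simp
    qed
  qed
  have "AE x in law 0. eventually (\<lambda>j. x \<in> space (law 0) - A j) sequentially"
  proof (rule borel_cantelli_AE1[OF _ _ sum])
    show "A j \<in> sets (law 0)" for j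
      unfolding A_def sets_law by (rule digits_sets[of "\<lambda>l. \<exists>d\<in>set l. \<not> d < enat (\<kappa> (n j))"])
  qed (simp add: emeasure_eq_measure)
  then show ?thesis using small_block
  proof eventually_elim
    case (elim x)
    have e1: "eventually (\<lambda>N. 0 < ln (ln (real N)) \<and> 1 < ln (real N)) sequentially"
      by (intro eventually_conj; real_asymp)
    have e2: "eventually (\<lambda>N. ln (ln (2 * real N)) / ln (ln (real N)) < b) sequentially"
    proof (rule order_tendstoD(2)[OF _ b(1)])
      show "(\<lambda>N. ln (ln (2 * real N)) / ln (ln (real N))) \<longlonglongrightarrow> 1" by real_asymp
    qed
    have "frequently (\<lambda>j. ratio x (t j + n j) \<le> ereal (b\<^sup>2 * c)) sequentially"
      using frequently_eventually_frequently[OF elim(2) eventually_conj[OF elim(1)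
          eventually_conj[OF eventually_compose_filterlim[OF e1 n_lim] eventually_compose_filterlim[OF e2 n_lim]]]]
    proof (rule frequently_elim1)
      fix j
      assume *: "(\<forall>d\<in>set (digits (n j) ((theta_map \<theta> ^^ t j) x)). d < enat (\<kappa> (n j))) \<and>
        x \<in> space (law 0) - A j \<and> (0 < ln (ln (real (n j))) \<and> 1 < ln (real (n j))) \<and>
        ln (ln (2 * real (n j))) / ln (ln (real (n j))) < b"
      define l where "l = ln (ln (real (n j)))"
      have n1: "1 \<le> n j" by (simp add: n_def)
      have l: "0 < l" using * by (simp add: l_def)
      have "real (t j) \<le> real (n j)"
      proof -
        have "real (n j) / (real j + 1)\<^sup>2 \<le> real (n j) / 1" by (intro divide_left_mono) auto
        then show ?thesis using t_le[of j] by simp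
      qed
      then have M: "n j \<le> t j + n j" "real (t j + n j) \<le> 2 * real (n j)" by simp_all
      have "\<forall>d\<in>set (digits (t j + n j) x). d < enat (\<kappa> (n j))"
        using * by (auto simp: digits_append A_def)
      then have max: "max_digit \<theta> (t j + n j) x < enat (\<kappa> (n j))"
        using n1 by (subst max_digit_less_iff) auto
      have "1 < ln (real (n j))" using * by simp
      also have "\<dots> \<le> ln (real (t j + n j))" using M(1) n1 by (intro ln_mono) auto
      finally have ln1: "1 < ln (real (t j + n j))" .
      have "ln (real (t j + n j)) \<le> ln (2 * real (n j))" using M n1 by (intro ln_mono) auto
      then have up: "ln (ln (real (t j + n j))) \<le> ln (ln (2 * real (n j)))" using ln1 by (subst ln_le_cancel_iff) linarith+
      have pos: "0 < ln (ln (real (t j + n j)))" using ln1 by simp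
      have \<kappa>: "real (\<kappa> (n j)) \<le> b * c * real (n j) / l"
        unfolding \<kappa>_def l_def[symmetric] using b c_pos l by simp
      have "real (\<kappa> (n j)) * ln (ln (real (t j + n j))) / real (t j + n j)
          \<le> (b * c * real (n j) / l) * ln (ln (2 * real (n j))) / real (n j)"
        using \<kappa> up pos order_trans[OF less_imp_le[OF pos] up] M(1) n1 b c_pos l
        by (intro frac_le mult_mono mult_nonneg_nonneg divide_nonneg_pos) auto
      also have "\<dots> = b * c * (ln (ln (2 * real (n j))) / l)" using n1 by simp
      also have "\<dots> \<le> b * c * b" using * b c_pos by (intro mult_left_mono) (auto simp: l_def)
      finally show "ratio x (t j + n j) \<le> ereal (b\<^sup>2 * c)"
        using max pos n1 by (intro ratio_le[of _ _ "\<kappa> (n j)"]) (auto simp: power2_eq_square mult_ac)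
    qed
    moreover have "filterlim (\<lambda>j. t j + n j) at_top sequentially"
      by (rule filterlim_at_top_mono[OF n_lim]) auto
    ultimately show "frequently (\<lambda>N. ratio x N \<le> ereal (b\<^sup>2 * c)) sequentially"
      unfolding frequently_def
      using eventually_compose_filterlim[of "\<lambda>N. \<not> ratio x N \<le> ereal (b\<^sup>2 * c)" sequentially "\<lambda>j. t j + n j" sequentially]
      by blast
  qed
qed

lemma AE_liminf: "AE x in law 0. liminf (ratio x) = ereal c"
proof -
  have "AE x in law 0. \<forall>i. eventually (\<lambda>N. ereal ((1 - 1 / real (i + 2)) * c) \<le> ratio x N) sequentially"
    by (subst AE_all_countable) (auto intro!: AE_eventually_ratio_ge)
  moreover have "AE x in law 0. \<forall>i. frequently (\<lambda>N. ratio x N \<le> ereal ((1 + 1 / real (i + 2))\<^sup>2 * c)) sequentially"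
    by (subst AE_all_countable) (auto intro!: AE_frequently_ratio_le)
  ultimately show ?thesis
  proof eventually_elim
    case (elim x)
    have ge: "ereal ((1 - 1 / real (i + 2)) * c) \<le> liminf (ratio x)" for i
      using elim(1) by (intro Liminf_bounded) blast
    have "(\<lambda>i. ereal ((1 - 1 / real (i + 2)) * c)) \<longlonglongrightarrow> ereal c"
      by (intro tendsto_ereal) real_asymp
    then have lo: "ereal c \<le> liminf (ratio x)" by (rule LIMSEQ_le_const2) (use ge in simp)
    have le: "liminf (ratio x) \<le> ereal ((1 + 1 / real (i + 2))\<^sup>2 * c)" for i
    proof (rule ccontr)
      assume "\<not> ?thesis"
      then have "eventually (\<lambda>N. ereal ((1 + 1 / real (i + 2))\<^sup>2 * c) < ratio x N) sequentially"
        by (intro less_LiminfD) auto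
      then show False using elim(2) by (auto simp: frequently_def not_le)
    qed
    have "(\<lambda>i. ereal ((1 + 1 / real (i + 2))\<^sup>2 * c)) \<longlonglongrightarrow> ereal c"
      by (intro tendsto_ereal) real_asymp
    then have "liminf (ratio x) \<le> ereal c" by (rule LIMSEQ_le_const) (use le in simp)
    with lo show ?case by simp
  qed
qed

end

text \<open>
  The law for \<open>s = 0\<close> is the normalised Lebesgue measure on \<open>(0, \<theta>)\<close>, so it only remains to
  add the null set of the two end points.
\<close>
theorem theorem5p2:
  fixes m :: nat and \<theta> :: real
  assumes "m \<ge> 1" and "\<theta> = 1 / sqrt (real m)"
  shows "AE x in lebesgue_on {0..\<theta>}.
    liminf (\<lambda>N. ereal_of_enat (max_digit \<theta> N x) * ereal (ln (ln (real N))) / ereal (real N))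
      = ereal (1 / ln (1 + \<theta>\<^sup>2))"
proof -
  interpret theta_expansion m \<theta> using assms by unfold_locales
  have "AE x in lborel. 0 < indicator {0<..<\<theta>} x * ennreal (law_density 0 x) \<longrightarrow> liminf (ratio x) = ereal c"
    using AE_liminf unfolding law_def by (subst (asm) AE_density) auto
  then have "AE x in lborel. x \<in> {0..\<theta>} \<longrightarrow> liminf (ratio x) = ereal c"
    using AE_lborel_singleton[of 0] AE_lborel_singleton[of \<theta>]
  proof eventually_elim
    case (elim x)
    then show ?case using theta_pos by (auto simp: law_density_def)
  qed
  then have "AE x in lebesgue. x \<in> {0..\<theta>} \<longrightarrow> liminf (ratio x) = ereal c"
    by (rule AE_completion)
  then show ?thesis by (simp add: AE_restrict_space_iff ratio_def[abs_def] c_def)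
qed

end
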